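(* Let $k\in\mathbb{N}$ and $m=2^k$, and suppose that $\mu(n',p)=U(n',p)$ for all $n'\in\mathbb{N}$ and all $p<m$. Let $n=q(2m-1)$ for some $q\in\mathbb{N}$, and let $W\in A(n,m)$ satisfy $M(W,0)=\mu(n,m)$. Then $W$ can be transformed, by a finite sequence of full and partial pivots, into the block diagonal wiring $\operatorname{diag}(V_k,\dots,V_k)$ ($q$ diagonal blocks), up to relabeling of the vertices.
   Context: $\mathbb{F}_2$ is the field with two elements; for $u\in\mathbb{F}_2^n$, $|u|$ is the number of entries equal to $1$. A wiring on $n$ vertices is an $n\times n$ matrix $W=(w_{i,j})$ over $\mathbb{F}_2$; its graph has vertex set $\{1,\dots,n\}$ and an edge from $j$ to $i$ whenever $w_{i,j}=1$ (column $j$ records which vertices are toggled by vertex $j$); $F(j)=\{i: w_{i,j}=1\}$. $M(W,0)=\max\{|Wx|:x\in\mathbb{F}_2^n\}$. For $n,m\ge1$, $A(n,m)$ is the set of wirings on $n$ vertices with all diagonal entries $1$ and every column containing at most $m$ ones, and $\mu(n,m)=\min\{M(W,0):W\in A(n,m)\}$. Pivoting: for a vertex $i$ and a set $T$ of vertices, $W^{i,T}$ is obtained from $W$ by replacing the $j$th column by the $i$th column for every $j\in F(i)\setminus T$; this is a full pivot if $T=\emptyset$ and a partial pivot otherwise. The sequence $(a(n))$: $a(1)=1$; $a(2^j-1+i)=2^{j-1}+a(i)$ for $1\le i\le 2^j-1$, $j\in\mathbb{N}$; $a(2^{j+1}-1)=2^j$. For $n,m\in\mathbb{N}$, let $j\ge0$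 satisfy $2^j\le m<2^{j+1}$ and write $n=(2^{j+1}-1)q+r$ with $q\ge0$, $1\le r\le 2^{j+1}-1$; then $U(n,m)=q2^j+a(r)$. The wiring $V_k$ on $2^{k+1}-1$ vertices: its vertex set is partitioned into blocks $\overline K_0,\overline K_1,\dots,\overline K_k$ with $|\overline K_i|=2^i$; within each block every vertex toggles every vertex of that block (including itself); all vertices of $\overline K_i$ have identical columns; a vertex of $\overline K_i$ toggles no vertex of $\overline K_j$ for $j<i$ and exactly $2^{j-1}$ vertices of $\overline K_j$ for each $j>i$; and for each $j$, pressing one vertex from each of any nonempty collection of blocks $\overline K_i$ with $i<j$ toggles exactly $2^{j-1}$ vertices of $\overline K_j$. Such a wiring exists and is unique up to relabeling of vertices within blocks; explicitly, one realization is obtained by deleting the first row and column of the Sylvester–Hadamard matrix $H_{2^{k+1}}$ (with $H_2=\begin{pmatrix}1&1\\1&-1\end{pmatrix}$, $H_{2^{j}}=H_2\otimes H_{2^{j-1}}$), replacing $1$ by $0$ and $-1$ by $1$ to get a matrix $W'$, and letting column $i$ of $V_k$ be column $2^j$ of $W'$ whenever $2^j\le i<2^{j+1}$. $V_k\in A(2^{k+1}-1,2^k)$, with every column having exactly $2^k$ ones. *)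

theory Defs
  imports
    "Jordan_Normal_Form.Matrix"
    "HOL-Library.Z2"
    "HOL-Library.Discrete_Functions"
    "HOL-Combinatorics.Permutations"
begin

text \<open>
  A wiring on \<open>n\<close> vertices is an element of \<^term>\<open>carrier_mat n n :: bit mat set\<close>, where
  \<^typ>\<open>bit\<close> is the field with two elements.  Matrix indices start at 0, so the vertex
  called \<open>i\<close> in the usual numbering \<open>1, \<dots>, n\<close> is the index \<open>i - 1\<close> here.
\<close>

definition weight :: "bit vec \<Rightarrow> nat" where
  "weight u = card {i. i < dim_vec u \<and> u $ i = 1}"

definition toggles :: "bit mat \<Rightarrow> nat \<Rightarrow> nat set" where
  "toggles W j = {i. i < dim_row W \<and> W $$ (i, j) = 1}"

definition max_weight :: "bit mat \<Rightarrow> nat" where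
  "max_weight W = Max {weight (W *\<^sub>v x) | x. x \<in> carrier_vec (dim_col W)}"

definition wirings :: "nat \<Rightarrow> nat \<Rightarrow> bit mat set" where
  "wirings n m = {W \<in> carrier_mat n n.
     (\<forall>i<n. W $$ (i, i) = 1) \<and> (\<forall>j<n. weight (col W j) \<le> m)}"

definition mu :: "nat \<Rightarrow> nat \<Rightarrow> nat" where
  "mu n m = Min (max_weight ` wirings n m)"

text \<open>
  Both extrema range over nonempty sets of numbers bounded by \<open>n\<close> (for \<open>m \<ge> 1\<close>), so that
  \<^const>\<open>Max\<close> and \<^const>\<open>Min\<close> have their usual meaning.
\<close>

lemma weight_le: "weight u \<le> dim_vec u"
proof -
  have "weight u \<le> card {..<dim_vec u}"
    unfolding weight_def by (intro card_mono) auto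
  then show ?thesis by simp
qed

lemma max_weight_set:
  assumes "W \<in> carrier_mat n n"
  shows "finite {weight (W *\<^sub>v x) | x. x \<in> carrier_vec (dim_col W)}"
    and "{weight (W *\<^sub>v x) | x. x \<in> carrier_vec (dim_col W)} \<noteq> {}"
    and "max_weight W \<le> n"
proof -
  let ?S = "{weight (W *\<^sub>v x) | x. x \<in> carrier_vec (dim_col W)}"
  have "weight (W *\<^sub>v x) \<le> n" for x
    using weight_le[of "W *\<^sub>v x"] assms by auto
  then have sub: "?S \<subseteq> {..n}" by auto
  then show fin: "finite ?S" by (rule finite_subset) simp
  show ne: "?S \<noteq> {}" using zero_carrier_vec[of "dim_col W"] by blast
  show "max_weight W \<le> n"
    unfolding max_weight_def using Max_in[OF fin ne] sub by auto
qed

lemma mu_set: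
  assumes "m \<ge> 1"
  shows "finite (max_weight ` wirings n m)" and "max_weight ` wirings n m \<noteq> {}"
proof -
  have "max_weight ` wirings n m \<subseteq> {..n}"
    using max_weight_set(3) by (auto simp: wirings_def)
  then show "finite (max_weight ` wirings n m)" by (rule finite_subset) simp
  have "weight (col (1\<^sub>m n) j) \<le> m" if "j < n" for j
  proof -
    have "{i. i < dim_vec (col (1\<^sub>m n :: bit mat) j) \<and> col (1\<^sub>m n :: bit mat) j $ i = 1} = {j}"
      using that by (auto split: if_splits)
    then show ?thesis using assms unfolding weight_def by simp
  qed
  then have "1\<^sub>m n \<in> wirings n m" by (auto simp: wirings_def)
  then show "max_weight ` wirings n m \<noteq> {}" by auto
qed

definition pivot :: "bit mat \<Rightarrow> nat \<Rightarrow> nat set \<Rightarrow> bit mat" where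
  "pivot W i T = mat (dim_row W) (dim_col W)
     (\<lambda>(r, j). if j \<in> toggles W i - T then W $$ (r, i) else W $$ (r, j))"

text \<open>The case \<open>T = {}\<close> is a full pivot, any other \<open>T\<close> gives a partial pivot.\<close>

definition pivot_rel :: "(bit mat \<times> bit mat) set" where
  "pivot_rel = {(W, pivot W i T) | W i T. i < dim_col W \<and> T \<subseteq> {..<dim_col W}}"

text \<open>\<open>W'\<close> is \<open>W\<close> with each vertex \<open>\<pi> i\<close> renamed to \<open>i\<close>.\<close>

definition relabeling :: "bit mat \<Rightarrow> bit mat \<Rightarrow> bool" where
  "relabeling W W' \<longleftrightarrow> (\<exists>n \<pi>. W \<in> carrier_mat n n \<and> W' \<in> carrier_mat n n \<and>
     \<pi> permutes {..<n} \<and> (\<forall>i<n. \<forall>j<n. W $$ (\<pi> i, \<pi> j) = W' $$ (i, j)))"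

text \<open>
  The sequence \<open>a\<close>; with \<open>j = floor_log n\<close> we have \<open>2 ^ j \<le> n < 2 ^ (j + 1)\<close>, which selects
  the applicable defining equation.  The value at 0 is irrelevant.
\<close>

function a_seq :: "nat \<Rightarrow> nat" where
  "a_seq n = (if n = 0 then 0
     else if n = 2 ^ (floor_log n + 1) - 1 then 2 ^ floor_log n
     else 2 ^ (floor_log n - 1) + a_seq (n - (2 ^ floor_log n - 1)))"
  by auto
termination
proof (relation "Wellfounded.measure id", simp, goal_cases)
  case (1 n)
  have "floor_log n \<noteq> 0"
  proof
    assume "floor_log n = 0"
    with 1 floor_log_exp2_gt[of n] show False by simp
  qed
  then have "(2::nat) ^ floor_log n > 1" by (intro one_less_power) auto
  with 1 show ?case by simp
qed

declare a_seq.simps [simp del]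

lemma a_seq_1: "a_seq 1 = 1"
  by (subst a_seq.simps) simp

lemma a_seq_add:
  assumes "j \<ge> 1" "1 \<le> i" "i \<le> 2 ^ j - 1"
  shows "a_seq (2 ^ j - 1 + i) = 2 ^ (j - 1) + a_seq i"
proof -
  have "(2::nat) ^ j \<ge> 1" by simp
  with assms have fl: "floor_log (2 ^ j - 1 + i) = j"
    by (intro floor_log_eqI) auto
  from assms have "2 ^ j - 1 + i \<noteq> 0" "2 ^ j - 1 + i \<noteq> 2 ^ (j + 1) - 1" by auto
  moreover have "2 ^ j - 1 + i - (2 ^ j - 1) = i" by (rule add_diff_cancel_left')
  ultimately show ?thesis by (subst a_seq.simps) (simp only: fl if_False)
qed

lemma a_seq_full: "a_seq (2 ^ (j + 1) - 1) = 2 ^ j"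
proof -
  obtain s where p: "(2::nat) ^ j = Suc s" by (cases "(2::nat) ^ j") auto
  have fl: "floor_log (2 ^ (j + 1) - 1) = j"
    by (intro floor_log_eqI) (auto simp: p)
  have "(2::nat) ^ (j + 1) - 1 \<noteq> 0" by (simp add: p)
  then show ?thesis by (subst a_seq.simps) (simp only: fl if_True if_False simp_thms)
qed

definition U :: "nat \<Rightarrow> nat \<Rightarrow> nat" where
  "U n m = (let j = floor_log m; N = 2 ^ (j + 1) - 1 in
     ((n - 1) div N) * 2 ^ j + a_seq ((n - 1) mod N + 1))"

lemma U_eq:
  assumes "2 ^ j \<le> m" "m < 2 ^ (j + 1)"
    and "n = (2 ^ (j + 1) - 1) * q + r" "1 \<le> r" "r \<le> 2 ^ (j + 1) - 1"
  shows "U n m = q * 2 ^ j + a_seq r"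
proof -
  define N :: nat where "N = 2 ^ (j + 1) - 1"
  have fl: "floor_log m = j"
    using assms(1,2) order.strict_trans2[of 0 "2 ^ j" m] by (intro floor_log_eqI) auto
  obtain s where s: "r = Suc s" using assms(4) by (cases r) auto
  have n: "n - 1 = N * q + s" and "s < N"
    using assms(3,5) s by (simp_all add: N_def)
  then have "(n - 1) div N = q" "(n - 1) mod N = s" by simp_all
  then show ?thesis
    unfolding U_def Let_def fl N_def[symmetric] s by simp
qed

text \<open>The Sylvester matrix of order \<open>2 ^ k\<close>, using \<open>H\<^sub>2 \<otimes> H = [[H, H], [H, -H]]\<close>.\<close>

fun sylvester :: "nat \<Rightarrow> int mat" where
  "sylvester 0 = 1\<^sub>m 1"
| "sylvester (Suc k) =
     four_block_mat (sylvester k) (sylvester k) (sylvester k) (- sylvester k)"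

text \<open>
  Row \<open>i\<close> of the matrix without its first row is row \<open>i + 1\<close> of the Sylvester matrix; the
  column of vertex number \<open>j + 1\<close> (counting from 1) is the one with number
  \<open>2 ^ floor_log (j + 1)\<close>.
\<close>

definition V :: "nat \<Rightarrow> bit mat" where
  "V k = mat (2 ^ (k + 1) - 1) (2 ^ (k + 1) - 1)
     (\<lambda>(i, j). if sylvester (k + 1) $$ (i + 1, 2 ^ floor_log (j + 1)) = -1 then 1 else 0)"

text \<open>
  The blocks of \<open>V k\<close>, and the properties which characterise \<open>V k\<close> up to relabeling of the
  vertices within the blocks.
\<close>

definition V_block :: "nat \<Rightarrow> nat set" where
  "V_block i = {2 ^ i - 1 ..< 2 ^ (i + 1) - 1}"

lemma sylvester_carrier: "sylvester k \<in> carrier_mat (2 ^ k) (2 ^ k)"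
  by (induction k) (auto simp: mult_2)

lemma sylvester_col_0: "i < 2 ^ k \<Longrightarrow> sylvester k $$ (i, 0) = 1"
proof (induction k arbitrary: i)
  case (Suc k)
  have d: "dim_row (sylvester k) = 2 ^ k" "dim_col (sylvester k) = 2 ^ k"
    using sylvester_carrier[of k] by auto
  show ?case using Suc d by (auto simp: mult_2)
qed simp

lemma sylvester_col_power:
  "i < 2 ^ k \<Longrightarrow> j < k \<Longrightarrow> sylvester k $$ (i, 2 ^ j) = (if bit i j then -1 else 1)"
proof (induction k arbitrary: i)
  case (Suc k)
  have d: "dim_row (sylvester k) = 2 ^ k" "dim_col (sylvester k) = 2 ^ k"
    using sylvester_carrier[of k] by auto
  have j2: "(2::nat) ^ j < 2 ^ k + 2 ^ k"
    using Suc.prems(2) power_strict_increasing[of j "Suc k" "2::nat"] by (simp add: mult_2)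
  have i2: "i < 2 ^ k + 2 ^ k" using Suc.prems(1) by (simp add: mult_2)
  have low: "bit (i - 2 ^ k) j = bit i j" if jk: "j < k" and ik: "\<not> i < 2 ^ k"
  proof -
    obtain y where y: "i = 2 ^ k + y" using ik by (metis le_add_diff_inverse linorder_not_less)
    have "take_bit k i = take_bit k y"
      by (simp add: y take_bit_eq_mod)
    then show ?thesis using jk y by (metis add_diff_cancel_left' bit_take_bit_iff)
  qed
  have top: "bit i k \<longleftrightarrow> \<not> i < 2 ^ k"
  proof (cases "i < 2 ^ k")
    case False
    then have "i div 2 ^ k = 1"
      using i2 by (intro div_nat_eqI) auto
    then show ?thesis using False by (simp add: bit_iff_odd)
  qed (simp add: bit_iff_odd)
  show ?case
  proof (cases "j = k")
    case True
    then show ?thesis using d i2 top by (auto simp: sylvester_col_0)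
  next
    case False
    then have jk: "j < k" using Suc.prems(2) by simp
    then have "(2::nat) ^ j < 2 ^ k" by simp
    then show ?thesis using d i2 j2 low[OF jk] Suc.IH[OF _ jk] by auto
  qed
qed simp

lemma floor_log_V_block: "j \<in> V_block i \<longleftrightarrow> floor_log (j + 1) = i"
proof
  assume "j \<in> V_block i"
  then show "floor_log (j + 1) = i"
    unfolding V_block_def by (intro floor_log_eqI) auto
next
  assume "floor_log (j + 1) = i"
  then show "j \<in> V_block i"
    using floor_log_exp2_le[of "j + 1"] floor_log_exp2_gt[of "j + 1"]
    unfolding V_block_def by auto
qed

lemma V_carrier: "V k \<in> carrier_mat (2 ^ (k + 1) - 1) (2 ^ (k + 1) - 1)"
  by (simp add: V_def)

lemma V_block_card: "card (V_block i) = 2 ^ i"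
  by (simp add: V_block_def)

lemma V_block_disjoint: "i \<noteq> j \<Longrightarrow> V_block i \<inter> V_block j = {}"
  by (auto simp: floor_log_V_block)

lemma V_block_subset: "i \<le> k \<Longrightarrow> V_block i \<subseteq> {..<2 ^ (k + 1) - 1}"
proof
  fix r assume "i \<le> k" "r \<in> V_block i"
  then have "r < 2 ^ (i + 1) - 1" by (simp add: V_block_def)
  also have "\<dots> \<le> 2 ^ (k + 1) - 1"
    using \<open>i \<le> k\<close> by (intro diff_le_mono power_increasing) auto
  finally show "r \<in> {..<2 ^ (k + 1) - 1}" by simp
qed

lemma V_block_Union: "(\<Union>i\<le>k. V_block i) = {..<2 ^ (k + 1) - 1}"
proof
  show "{..<2 ^ (k + 1) - 1} \<subseteq> (\<Union>i\<le>k. V_block i)"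
  proof
    fix j :: nat assume j: "j \<in> {..<2 ^ (k + 1) - 1}"
    have "2 ^ floor_log (j + 1) \<le> j + 1" by (intro floor_log_exp2_le) simp
    also have "\<dots> < 2 ^ (k + 1)" using j by auto
    finally have "floor_log (j + 1) < k + 1" by (simp only: power_strict_increasing_iff)
    then show "j \<in> (\<Union>i\<le>k. V_block i)" using floor_log_V_block by auto
  qed
qed (use V_block_subset in blast)

lemma V_entry:
  assumes "i \<le> k" "j \<in> V_block i" "r < 2 ^ (k + 1) - 1"
  shows "V k $$ (r, j) = of_bool (bit (r + 1) i)"
proof -
  have "j < 2 ^ (k + 1) - 1" using V_block_subset[OF assms(1)] assms(2) by auto
  moreover have "floor_log (j + 1) = i" using assms(2) floor_log_V_block by simp
  moreover have "sylvester (k + 1) $$ (r + 1, 2 ^ i) = (if bit (r + 1) i then -1 else 1)"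
    using assms(1,3) by (intro sylvester_col_power) auto
  ultimately show ?thesis using assms(3) unfolding V_def by simp
qed

lemma V_block_same_column:
  assumes "i \<le> k" "j \<in> V_block i" "j' \<in> V_block i"
  shows "col (V k) j = col (V k) j'"
proof -
  have "j < 2 ^ (k + 1) - 1" "j' < 2 ^ (k + 1) - 1"
    using V_block_subset[OF assms(1)] assms(2,3) by auto
  then show ?thesis
    using V_entry[OF assms(1)] assms(2,3) V_carrier[of k] by (intro eq_vecI) auto
qed

lemma bit_top_block:
  assumes "r \<in> V_block i"
  shows "bit (r + 1) i" and "i < j \<Longrightarrow> \<not> bit (r + 1) j"
proof -
  have r: "2 ^ i \<le> r + 1" "r + 1 < 2 ^ i + 2 ^ i"
    using assms unfolding V_block_def by auto
  then have "(r + 1) div 2 ^ i = 1" by (intro div_nat_eqI) auto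
  then show "bit (r + 1) i" by (simp add: bit_iff_odd)
  assume "i < j"
  then have "(2::nat) ^ Suc i \<le> 2 ^ j" by (intro power_increasing) auto
  then have "r + 1 < 2 ^ j" using r by simp
  then show "\<not> bit (r + 1) j" by (simp add: bit_iff_odd)
qed

lemma V_block_complete:
  assumes "i \<le> k" "j \<in> V_block i" "r \<in> V_block i"
  shows "V k $$ (r, j) = 1"
  using V_entry[OF assms(1,2)] bit_top_block(1)[OF assms(3)] V_block_subset[OF assms(1)] assms(3)
  by auto

lemma V_block_lower:
  assumes "i \<le> k" "l < i" "j \<in> V_block i" "r \<in> V_block l"
  shows "V k $$ (r, j) = 0"
  using V_entry[OF assms(1,3)] bit_top_block(2)[OF assms(4,2)] V_block_subset[of l k] assms
  by auto

lemma card_odd_parity: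
  assumes "finite S" "s \<in> S" "S \<subseteq> {..<j}"
  shows "card {r \<in> V_block j. (\<Sum>i\<in>S. of_bool (bit (r + 1) i)) = (1::bit)} = 2 ^ (j - 1)"
proof -
  define P :: "nat \<Rightarrow> bit" where "P y = (\<Sum>i\<in>S. of_bool (bit y i))" for y
  define Y :: "nat set" where "Y = {2 ^ j ..< 2 ^ (j + 1)}"
  have s: "s < j" using assms(2,3) by auto
  have Y_iff: "y \<in> Y \<longleftrightarrow> drop_bit j y = 1" for y
  proof
    assume "y \<in> Y"
    then have "y div 2 ^ j = 1" unfolding Y_def by (intro div_nat_eqI) auto
    then show "drop_bit j y = 1" by (simp add: drop_bit_eq_div)
  next
    assume "drop_bit j y = 1"
    then have q: "y div 2 ^ j = 1" by (simp add: drop_bit_eq_div)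
    have "y = y div 2 ^ j * 2 ^ j + y mod 2 ^ j" by (rule div_mult_mod_eq[symmetric])
    moreover have "y mod 2 ^ j < 2 ^ j" by simp
    ultimately have "2 ^ j \<le> y" "y < 2 ^ j + 2 ^ j" unfolding q by linarith+
    then show "y \<in> Y" by (simp add: Y_def)
  qed
  have flip_flip: "flip_bit s (flip_bit s y) = y" for y :: nat
    by (rule bit_eqI) (auto simp: bit_flip_bit_iff)
  have "drop_bit j (flip_bit s y) = drop_bit j y" for y :: nat
    using s by (intro bit_eqI) (auto simp: bit_flip_bit_iff bit_drop_bit_eq)
  then have flip_Y: "flip_bit s y \<in> Y \<longleftrightarrow> y \<in> Y" for y by (simp add: Y_iff)
  have flip_P: "P (flip_bit s y) = P y + 1" for y
  proof -
    have "P (flip_bit s y) = of_bool (\<not> bit y s) + (\<Sum>i\<in>S - {s}. of_bool (bit y i))"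
      unfolding P_def using assms(1,2)
      by (subst sum.remove[of _ s]) (auto simp: bit_flip_bit_iff intro!: sum.cong)
    also have "\<dots> = P y + 1"
      unfolding P_def using assms(1,2) by (subst (2) sum.remove[of _ s]) auto
    finally show ?thesis .
  qed
  define A where "A = {y \<in> Y. P y = 1}"
  define B where "B = {y \<in> Y. P y = 0}"
  have "bij_betw (flip_bit s) A B"
    by (rule bij_betwI[where g = "flip_bit s"])
      (auto simp: A_def B_def flip_Y flip_P flip_flip)
  then have "card A = card B" by (rule bij_betw_same_card)
  moreover have "card A + card B = card (A \<union> B)"
    by (rule card_Un_disjoint[symmetric]) (auto simp: A_def B_def Y_def)
  moreover have "A \<union> B = Y" by (auto simp: A_def B_def)
  ultimately have "2 * card A = 2 ^ j" by (simp add: Y_def)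
  then have card_A: "card A = 2 ^ (j - 1)" using s by (cases j) auto
  have bij: "bij_betw Suc {r \<in> V_block j. P (r + 1) = 1} A"
  proof (rule bij_betwI[where g = "\<lambda>y. y - 1"])
    have "y > 0" if "y \<in> Y" for y
      using that order.strict_trans2[of 0 "2 ^ j" y] by (auto simp: Y_def)
    then show "(\<lambda>y. y - 1) \<in> A \<rightarrow> {r \<in> V_block j. P (r + 1) = 1}"
      by (auto simp: A_def Y_def V_block_def)
    show "Suc (y - 1) = y" if "y \<in> A" for y
      using that order.strict_trans2[of 0 "2 ^ j" y] by (auto simp: A_def Y_def)
  qed (auto simp: A_def Y_def V_block_def)
  show ?thesis
    using bij_betw_same_card[OF bij] card_A by (simp add: P_def)
qed

lemma V_block_higher:
  assumes "j \<le> k" "S \<noteq> {}" "S \<subseteq> {..<j}" "\<And>i. i \<in> S \<Longrightarrow> v i \<in> V_block i"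
  shows "card {r \<in> V_block j. (\<Sum>i\<in>S. V k $$ (r, v i)) = 1} = 2 ^ (j - 1)"
proof -
  obtain s where "s \<in> S" using assms(2) by blast
  have "finite S" using assms(3) finite_subset by blast
  have "(\<Sum>i\<in>S. V k $$ (r, v i)) = (\<Sum>i\<in>S. of_bool (bit (r + 1) i))" if "r \<in> V_block j" for r
  proof (rule sum.cong)
    fix i assume i: "i \<in> S"
    then have "i \<le> k" using assms(1,3) by auto
    then show "V k $$ (r, v i) = of_bool (bit (r + 1) i)"
      using V_entry assms(4)[OF i] V_block_subset[OF assms(1)] that by blast
  qed simp
  then have "{r \<in> V_block j. (\<Sum>i\<in>S. V k $$ (r, v i)) = 1}
    = {r \<in> V_block j. (\<Sum>i\<in>S. of_bool (bit (r + 1) i)) = (1::bit)}" by auto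
  then show ?thesis
    using card_odd_parity[OF \<open>finite S\<close> \<open>s \<in> S\<close> assms(3)] by simp
qed

end

theory Submission
  imports Defs
begin

text \<open>
  Write \<open>m = 2h\<close>.  Full pivots, made partial so as not to disturb earlier ones, split off
  \<open>t\<close> disjoint blocks of \<open>m\<close> vertices toggling exactly their own block, until the wiring
  restricted to the set \<open>R\<close> of remaining vertices has column weights below \<open>m\<close>.  Toggling the
  blocks independently, every sum \<open>v\<close> of columns satisfies
  \<open>|v \<inter> R| + (\<Sum>B. max |v \<inter> B| (m - |v \<inter> B|)) \<le> qm\<close>.  For \<open>v = 0\<close> this gives \<open>t \<le> q\<close>, and the known value
  of \<open>\<mu>(|R|, m - 1)\<close> excludes \<open>t < q\<close>.  For a single column it forces weight at most \<open>h\<close> on \<open>R\<close>,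
  so by induction \<open>R\<close> can be pivoted to \<open>q\<close> copies of \<open>V (k - 1)\<close>.

  A sum of columns with a nonzero contribution from every copy has weight \<open>qh\<close> on \<open>R\<close>, hence
  exactly \<open>h\<close> on every block.  Counting shows that different copies have disjoint supports on the
  blocks, so that each copy restricts to a constant weight code of some weight \<open>d\<close> on each block.  By
  Fourier inversion a given nonzero pattern of its \<open>k\<close> generators occurs \<open>d / h\<close> times, an integer, and
  so \<open>d \<in> {0, h}\<close>.  This matches the copies with the blocks, and when \<open>d = h\<close> every pattern occurs
  exactly once, which is the remaining block of \<open>V k\<close>.
\<close>

subsection \<open>Sums of column sets\<close>

text \<open>Columns over \<open>F_2\<close> are treated as sets of vertices. Summing over indices,
  not over the set of columns, lets equal columns at different indices cancel.\<close>

definition toggle_sum :: "('b \<Rightarrow> 'a set) \<Rightarrow> 'b set \<Rightarrow> 'a set" where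
  "toggle_sum c I = {x. odd (card {i \<in> I. x \<in> c i})}"

lemma toggle_sum_empty [simp]: "toggle_sum c {} = {}"
  by (simp add: toggle_sum_def)

lemma toggle_sum_insert:
  assumes "finite I" "j \<notin> I"
  shows "toggle_sum c (insert j I) = sym_diff (toggle_sum c I) (c j)"
proof -
  have "odd (card {i \<in> insert j I. x \<in> c i}) \<longleftrightarrow> odd (card {i \<in> I. x \<in> c i}) \<noteq> (x \<in> c j)" for x
  proof -
    have "{i \<in> insert j I. x \<in> c i} =
        (if x \<in> c j then insert j {i \<in> I. x \<in> c i} else {i \<in> I. x \<in> c i})"
      by auto
    then show ?thesis using assms by simp
  qed
  then show ?thesis unfolding toggle_sum_def by blast
qed

lemma toggle_sum_singleton [simp]: "toggle_sum c {j} = c j"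
  using toggle_sum_insert[of "{}" j c] by simp

text \<open>Passing to signs turns the mod 2 sum into a product, so that each \<open>I\<close> acts
  as a character.\<close>

lemma toggle_sum_sign:
  assumes "finite I"
  shows "(\<Prod>i\<in>I. if x \<in> c i then -1 else 1) = (if x \<in> toggle_sum c I then -1 else (1::int))"
  using assms by (induction I) (auto simp: toggle_sum_insert)

text \<open>The linear span over \<open>F_2\<close>, with \<open>sym_diff\<close> as addition. It
  depends only on the set of columns, so a pivot, which introduces no new column, can only shrink
  it.\<close>

inductive_set xspan :: "'a set set \<Rightarrow> 'a set set" for C where
  empty: "{} \<in> xspan C"
| add: "v \<in> xspan C \<Longrightarrow> c \<in> C \<Longrightarrow> sym_diff v c \<in> xspan C"

lemma xspan_mono:
  assumes "v \<in> xspan C" "C \<subseteq> D" shows "v \<in> xspan D"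
  using assms by (induction rule: xspan.induct) (auto intro: xspan.intros)

lemma toggle_sum_in_xspan:
  assumes "finite I" "c ` I \<subseteq> C" shows "toggle_sum c I \<in> xspan C"
  using assms by (induction I) (auto simp: toggle_sum_insert intro: xspan.intros)

lemma gen_in_xspan: "c \<in> C \<Longrightarrow> c \<in> xspan C"
  using xspan.add[OF xspan.empty] by fastforce

lemma card_sym_diff_subset:
  assumes "finite B" "c \<inter> B = B"
  shows "card (sym_diff v c \<inter> B) = card B - card (v \<inter> B)"
proof -
  have "sym_diff v c \<inter> B = B - (v \<inter> B)" using assms by auto
  then show ?thesis using assms by (simp add: card_Diff_subset)
qed

text \<open>Orthogonality of characters: the sum factors over \<open>K\<close>, and a factor is
  \<open>2\<close> where \<open>P\<close> and \<open>Q\<close> agree and \<open>0\<close> where they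
  differ.\<close>

lemma sum_pow_signs:
  assumes "finite K"
  shows "(\<Sum>I\<in>Pow K. (\<Prod>i\<in>I. if i \<in> P then -1 else 1) * (\<Prod>i\<in>I. if i \<in> Q then -1 else (1::int)))
    = (if P \<inter> K = Q \<inter> K then 2 ^ card K else 0)"
proof -
  let ?e = "\<lambda>i. (if i \<in> P then -1 else 1) * (if i \<in> Q then -1 else (1::int))"
  have "(\<Sum>I\<in>Pow K. (\<Prod>i\<in>I. if i \<in> P then -1 else 1) * (\<Prod>i\<in>I. if i \<in> Q then -1 else (1::int)))
    = (\<Sum>I\<in>Pow K. prod ?e I)"
    by (simp only: prod.distrib)
  also have "\<dots> = (\<Prod>i\<in>K. ?e i + 1)"
    using prod_add[OF assms, of ?e "\<lambda>_. 1"] by simp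
  also have "\<dots> = (if P \<inter> K = Q \<inter> K then 2 ^ card K else 0)"
  proof (cases "P \<inter> K = Q \<inter> K")
    case True
    then have "(\<Prod>i\<in>K. ?e i + 1) = (\<Prod>i\<in>K. 2)" by (intro prod.cong) auto
    then show ?thesis using True by simp
  next
    case False
    then obtain i where "i \<in> K" "(i \<in> P) \<noteq> (i \<in> Q)" by auto
    then show ?thesis using False assms by (auto intro!: prod_zero)
  qed
  finally show ?thesis .
qed

text \<open>Fourier inversion over the characters of the group \<open>Pow {..<k}\<close>.\<close>

lemma constant_weight_patterns:
  fixes c :: "nat \<Rightarrow> 'a set"
  assumes "finite B" "card B = 2 ^ k"
    and d: "\<And>I. I \<subseteq> {..<k} \<Longrightarrow> I \<noteq> {} \<Longrightarrow> card (toggle_sum c I \<inter> B) = d"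
    and P: "P \<subseteq> {..<k}"
  shows "2 ^ k * int (card {x \<in> B. {i \<in> {..<k}. x \<in> c i} = P}) =
    2 ^ k + (2 ^ k - 2 * int d) * ((if P = {} then 2 ^ k else 0) - 1)"
proof -
  define t where "t I = (\<Prod>i\<in>I. if i \<in> P then -1 else (1::int))" for I
  define s where "s x I = (if x \<in> toggle_sum c I then -1 else (1::int))" for x I
  have s_prod: "s x I = (\<Prod>i\<in>I. if i \<in> {i \<in> {..<k}. x \<in> c i} then -1 else 1)"
    if "I \<in> Pow {..<k}" for x I
  proof -
    have "finite I" using that finite_subset by auto
    then have "s x I = (\<Prod>i\<in>I. if x \<in> c i then -1 else 1)"
      unfolding s_def by (rule toggle_sum_sign[symmetric])
    also have "\<dots> = (\<Prod>i\<in>I. if i \<in> {i \<in> {..<k}. x \<in> c i} then -1 else 1)"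
      using that by (intro prod.cong) auto
    finally show ?thesis .
  qed
  \<comment> \<open>By orthogonality this sum detects whether \<open>x\<close> has the pattern
    \<open>P\<close>.\<close>
  have 1: "(\<Sum>I\<in>Pow {..<k}. t I * s x I) = (if {i \<in> {..<k}. x \<in> c i} = P then 2 ^ k else 0)" for x
  proof -
    have "(\<Sum>I\<in>Pow {..<k}. t I * s x I) = (\<Sum>I\<in>Pow {..<k}. t I *
        (\<Prod>i\<in>I. if i \<in> {i \<in> {..<k}. x \<in> c i} then -1 else 1))"
      using s_prod by (intro sum.cong) auto
    also have "\<dots> = (if P \<inter> {..<k} = {i \<in> {..<k}. x \<in> c i} \<inter> {..<k} then 2 ^ card {..<k} else 0)"
      unfolding t_def by (rule sum_pow_signs) simp
    finally show ?thesis using P by (auto simp: Int_absorb2)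
  qed
  have 2: "(\<Sum>x\<in>B. s x I) = 2 ^ k - 2 * int (card (toggle_sum c I \<inter> B))" for I
  proof -
    have "(\<Sum>x\<in>B. s x I) = (\<Sum>x\<in>B. 1 - 2 * (if x \<in> toggle_sum c I then 1 else 0))"
      by (intro sum.cong) (auto simp: s_def)
    also have "\<dots> = int (card B) - 2 * int (card (B \<inter> toggle_sum c I))"
      using assms(1)
      by (simp add: sum_subtractf flip: sum_distrib_left sum.inter_restrict)
    finally show ?thesis using assms(2) by (simp add: Int_commute)
  qed
  have "2 ^ k * int (card {x \<in> B. {i \<in> {..<k}. x \<in> c i} = P})
      = (\<Sum>x\<in>B. \<Sum>I\<in>Pow {..<k}. t I * s x I)"
    using assms(1) by (simp add: 1 flip: sum.inter_filter)
  also have "\<dots> = (\<Sum>I\<in>Pow {..<k}. t I * (\<Sum>x\<in>B. s x I))"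
    by (subst sum.swap) (simp add: sum_distrib_left)
  \<comment> \<open>The term for \<open>{}\<close> is split off because the weight \<open>d\<close>
    is assumed only for nonempty \<open>I\<close>; the empty sum has weight 0.\<close>
  also have "\<dots> = t {} * 2 ^ k + (\<Sum>I\<in>Pow {..<k} - {{}}. t I * (2 ^ k - 2 * int d))"
    by (subst sum.remove[of _ "{}"]) (auto simp: 2 d intro!: sum.cong)
  also have "\<dots> = 2 ^ k + (2 ^ k - 2 * int d) * ((\<Sum>I\<in>Pow {..<k}. t I) - 1)"
    by (subst (2) sum.remove[of _ "{}"])
      (auto simp: t_def mult.commute sum_distrib_left)
  also have "(\<Sum>I\<in>Pow {..<k}. t I) = (if P = {} then 2 ^ k else 0)"
    using sum_pow_signs[of "{..<k}" P "{}"] P by (auto simp: t_def Int_absorb2)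
  finally show ?thesis .
qed

section \<open>Sums without cancellation, and parities of bits\<close>

lemma sum_card_inter:
  assumes "finite J" "finite A"
  shows "(\<Sum>p\<in>J. card (C p \<inter> A)) = (\<Sum>x\<in>A. card {p \<in> J. x \<in> C p})"
proof -
  have "(\<Sum>p\<in>J. card (C p \<inter> A)) = (\<Sum>p\<in>J. \<Sum>x\<in>A. if x \<in> C p then 1 else 0)"
    using assms by (simp add: Int_commute flip: sum.inter_restrict)
  also have "\<dots> = (\<Sum>x\<in>A. \<Sum>p\<in>J. if x \<in> C p then 1 else 0)" by (rule sum.swap)
  also have "\<dots> = (\<Sum>x\<in>A. card {p \<in> J. x \<in> C p})"
    using assms by (simp flip: sum.inter_filter)
  finally show ?thesis .
qed

text \<open>A point counts at most once in the mod 2 sum, but at least twice on the left of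
  \<open>le\<close> if two columns share it. Hence equality of the total weights excludes
  overlaps.\<close>

lemma toggle_sum_tight_disjoint:
  assumes "finite J" "finite A"
    and le: "(\<Sum>p\<in>J. card (C p \<inter> A)) \<le> card (toggle_sum C J \<inter> A)"
    and "p \<in> J" "p' \<in> J" "p \<noteq> p'"
  shows "C p \<inter> C p' \<inter> A = {}"
proof (rule ccontr)
  assume "C p \<inter> C p' \<inter> A \<noteq> {}"
  then obtain x where x: "x \<in> A" "x \<in> C p" "x \<in> C p'" by auto
  have "{p, p'} \<subseteq> {p \<in> J. x \<in> C p}" using x assms by auto
  then have two: "card {p \<in> J. x \<in> C p} \<ge> 2"
    using assms card_mono[of "{p \<in> J. x \<in> C p}" "{p, p'}"] by auto
  have "card (toggle_sum C J \<inter> A) = (\<Sum>x\<in>A. if x \<in> toggle_sum C J then 1 else 0)"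
    using assms by (simp add: Int_commute flip: sum.inter_restrict)
  also have "\<dots> < (\<Sum>x\<in>A. card {p \<in> J. x \<in> C p})"
  proof (rule sum_strict_mono_strong[OF \<open>finite A\<close> x(1)])
    show "(if x \<in> toggle_sum C J then 1 else 0) < card {p \<in> J. x \<in> C p}" using two by auto
    show "(if y \<in> toggle_sum C J then 1 else 0) \<le> card {p \<in> J. y \<in> C p}" for y
      by (auto simp: toggle_sum_def elim!: oddE)
  qed
  finally show False using le sum_card_inter[OF assms(1,2), of C] by simp
qed

text \<open>Each point of \<open>B\<close> is met by columns of at most one \<open>u\<close>, so
  cancellation happens only within a single \<open>u\<close>. This is needed both on the remainder,
  where the copies are disjoint by construction, and on the pure blocks.\<close>

lemma card_toggle_sum_Sigma:
  assumes "finite Q" "finite B" "\<And>u. u \<in> Q \<Longrightarrow> finite (I u)"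
    and disj: "\<And>x u u' i i'. x \<in> B \<Longrightarrow> u \<in> Q \<Longrightarrow> u' \<in> Q \<Longrightarrow> u \<noteq> u' \<Longrightarrow> i \<in> I u \<Longrightarrow>
      i' \<in> I u' \<Longrightarrow> x \<in> c u i \<Longrightarrow> x \<notin> c u' i'"
  shows "card (toggle_sum (\<lambda>(u, i). c u i) (Sigma Q I) \<inter> B) =
    (\<Sum>u\<in>Q. card (toggle_sum (c u) (I u) \<inter> B))"
proof -
  have eq: "x \<in> toggle_sum (\<lambda>(u, i). c u i) (Sigma Q I) \<longleftrightarrow> (\<exists>u\<in>Q. x \<in> toggle_sum (c u) (I u))"
    (is "?L \<longleftrightarrow> ?R") if x: "x \<in> B" for x
  proof
    assume ?L
    then have o: "odd (card {p \<in> Sigma Q I. x \<in> (case p of (u, i) \<Rightarrow> c u i)})"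
      by (simp add: toggle_sum_def)
    then obtain p where "p \<in> Sigma Q I" "x \<in> (case p of (u, i) \<Rightarrow> c u i)"
      by (metis (mono_tags, lifting) Collect_empty_eq card.empty even_zero)
    then obtain u i where u: "u \<in> Q" "i \<in> I u" "x \<in> c u i" by auto
    have u_unique: "a = u" if "a \<in> Q" "b \<in> I a" "x \<in> c a b" for a b
    proof (rule ccontr)
      assume "a \<noteq> u"
      then have "x \<notin> c a b"
        using disj[OF x \<open>u \<in> Q\<close> that(1) _ \<open>i \<in> I u\<close> that(2) \<open>x \<in> c u i\<close>] by simp
      then show False using that(3) by simp
    qed
    have "{p \<in> Sigma Q I. x \<in> (case p of (u, i) \<Rightarrow> c u i)} = Pair u ` {i \<in> I u. x \<in> c u i}"
      using u by (auto dest: u_unique)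
    then have "odd (card {i \<in> I u. x \<in> c u i})" using o by (simp add: card_image inj_on_def)
    then show ?R using u by (auto simp: toggle_sum_def)
  next
    assume ?R
    then obtain u where u: "u \<in> Q" and o: "odd (card {i \<in> I u. x \<in> c u i})"
      by (auto simp: toggle_sum_def)
    then obtain i where i: "i \<in> I u" "x \<in> c u i"
      by (metis (mono_tags, lifting) Collect_empty_eq card.empty even_zero)
    have u_unique: "a = u" if "a \<in> Q" "b \<in> I a" "x \<in> c a b" for a b
    proof (rule ccontr)
      assume "a \<noteq> u"
      then have "x \<notin> c a b"
        using disj[OF x \<open>u \<in> Q\<close> that(1) _ \<open>i \<in> I u\<close> that(2) \<open>x \<in> c u i\<close>] by simp
      then show False using that(3) by simp
    qed
    have "{p \<in> Sigma Q I. x \<in> (case p of (u, i) \<Rightarrow> c u i)} = Pair u ` {i \<in> I u. x \<in> c u i}"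
      using u by (auto dest: u_unique)
    then show ?L using o by (simp add: card_image inj_on_def toggle_sum_def)
  qed
  have ex: "\<exists>i\<in>I u. x \<in> c u i" if "x \<in> toggle_sum (c u) (I u)" for x u
  proof (rule ccontr)
    assume "\<not> ?thesis"
    then have "{i \<in> I u. x \<in> c u i} = {}" by auto
    then show False using that by (simp only: toggle_sum_def mem_Collect_eq) simp
  qed
  have "toggle_sum (\<lambda>(u, i). c u i) (Sigma Q I) \<inter> B = (\<Union>u\<in>Q. toggle_sum (c u) (I u) \<inter> B)"
    using eq by auto
  also have "card \<dots> = (\<Sum>u\<in>Q. card (toggle_sum (c u) (I u) \<inter> B))"
  proof (rule card_UN_disjoint)
    show "\<forall>u\<in>Q. \<forall>u'\<in>Q. u \<noteq> u' \<longrightarrow>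
        toggle_sum (c u) (I u) \<inter> B \<inter> (toggle_sum (c u') (I u') \<inter> B) = {}"
    proof (intro ballI impI equals0I)
      fix u u' x
      assume u: "u \<in> Q" "u' \<in> Q" "u \<noteq> u'"
        and x: "x \<in> toggle_sum (c u) (I u) \<inter> B \<inter> (toggle_sum (c u') (I u') \<inter> B)"
      then obtain i i' where "i \<in> I u" "x \<in> c u i" "i' \<in> I u'" "x \<in> c u' i'"
        using ex[of x u] ex[of x u'] by auto
      then show False using disj[OF _ u] x by auto
    qed
  qed (use assms in auto)
  finally show ?thesis .
qed

text \<open>A nonzero linear form on \<open>k\<close> bits is odd on half of all strings, and
  leaving out 0 loses nothing because its parity is even. Setting the extra bit \<open>k\<close>
  moves the count into \<open>V_block k\<close>, where \<open>card_odd_parity\<close>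
  applies.\<close>

lemma card_odd_bits:
  assumes "I \<subseteq> {..<k}" "I \<noteq> {}"
  shows "card {y \<in> {1..<2 ^ k :: nat}. odd (card {i \<in> I. bit y i})} = 2 ^ (k - 1)"
proof -
  obtain s where "s \<in> I" using assms by auto
  have fin: "finite I" using assms finite_subset by auto
  let ?A = "{r \<in> V_block k. (\<Sum>i\<in>I. of_bool (bit (r + 1) i)) = (1::bit)}"
  let ?B = "{y \<in> {1..<2 ^ k}. odd (card {i \<in> I. bit (y::nat) i})}"
  have val: "(\<Sum>i\<in>I. of_bool (bit y i)) = (1::bit) \<longleftrightarrow> odd (card {i \<in> I. bit y i})" for y :: nat
  proof -
    have "(\<Sum>i\<in>I. of_bool (bit y i)) = (of_nat (card {i \<in> I. bit y i}) :: bit)"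
      using fin by (simp add: of_bool_def flip: sum.inter_filter)
    moreover have "(of_nat n :: bit) = of_bool (odd n)" for n by (induction n) auto
    ultimately show ?thesis by simp
  qed
  have bits: "bit (2 ^ k + y) i = bit y i" if "i \<in> I" for y i :: nat
  proof -
    have "take_bit k (2 ^ k + y) = take_bit k y" by (simp add: take_bit_eq_mod)
    moreover have "i < k" using that assms by auto
    ultimately show ?thesis by (metis bit_take_bit_iff)
  qed
  have par: "odd (card {i \<in> I. bit (2 ^ k + y) i}) \<longleftrightarrow> odd (card {i \<in> I. bit y i})" for y :: nat
  proof -
    have "{i \<in> I. bit (2 ^ k + y) i} = {i \<in> I. bit y i}" using bits by auto
    then show ?thesis by simp
  qed
  have "bij_betw (\<lambda>y. 2 ^ k + y - 1) ?B ?A"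
  proof (rule bij_betwI[where g = "\<lambda>r. r + 1 - 2 ^ k"])
    show "(\<lambda>y. 2 ^ k + y - 1) \<in> ?B \<rightarrow> ?A"
    proof
      fix y assume y: "y \<in> ?B"
      then have r: "2 ^ k + y - 1 + 1 = 2 ^ k + y" by simp
      have "odd (card {i \<in> I. bit (2 ^ k + y) i})" using y par[of y] by blast
      then have "(\<Sum>i\<in>I. of_bool (bit (2 ^ k + y - 1 + 1) i)) = (1::bit)"
        unfolding r val .
      then show "2 ^ k + y - 1 \<in> ?A" using y by (auto simp: V_block_def)
    qed
    show "(\<lambda>r. r + 1 - 2 ^ k) \<in> ?A \<rightarrow> ?B"
    proof
      fix r assume r: "r \<in> ?A"
      then obtain y where y: "r + 1 = 2 ^ k + y" "y < 2 ^ k"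
        by (auto simp: V_block_def intro!: that[of "r + 1 - 2 ^ k"])
      have "odd (card {i \<in> I. bit (r + 1) i})" using r unfolding val by blast
      then have o: "odd (card {i \<in> I. bit y i})" using par[of y] unfolding y by simp
      then have "y \<noteq> 0" by (auto intro: ccontr)
      then show "r + 1 - 2 ^ k \<in> ?B" using y o by auto
    qed
  qed (auto simp: V_block_def)
  then show ?thesis
    using card_odd_parity[OF fin \<open>s \<in> I\<close> assms(1)] bij_betw_same_card by fastforce
qed

subsection \<open>Partial pivots and pure blocks\<close>

text \<open>\<open>J\<close> is the complement of the set \<open>T\<close> in \<open>pivot\<close>.
  The columns are not cut down to \<open>S\<close>, so a pivot within a smaller vertex set is
  already a pivot of the whole wiring.\<close>

definition partial_pivots :: "'a set \<Rightarrow> (('a \<Rightarrow> 'a set) \<times> ('a \<Rightarrow> 'a set)) set" where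
  "partial_pivots S = {(F, \<lambda>j. if j \<in> J \<inter> F i then F i else F j) | F i J. i \<in> S \<and> J \<subseteq> S}"

lemma partial_pivots_mono: "R \<subseteq> S \<Longrightarrow> partial_pivots R \<subseteq> partial_pivots S"
  unfolding partial_pivots_def by blast

lemma partial_pivotsI:
  "i \<in> S \<Longrightarrow> J \<subseteq> S \<Longrightarrow> (F, \<lambda>j. if j \<in> J \<inter> F i then F i else F j) \<in> partial_pivots S"
  unfolding partial_pivots_def by blast

text \<open>A step only copies existing columns and only changes columns in \<open>S\<close>. A
  vertex \<open>j\<close> receives \<open>F i\<close> only if it lies in \<open>F i\<close>, which
  keeps the diagonal.\<close>

lemma partial_pivots_rtrancl:
  assumes "(F, G) \<in> (partial_pivots S)\<^sup>*"
  shows "G ` S \<subseteq> F ` S" and "j \<notin> S \<Longrightarrow> G j = F j"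
    and "(\<And>j. j \<in> S \<Longrightarrow> j \<in> F j) \<Longrightarrow> j \<in> S \<Longrightarrow> j \<in> G j"
proof -
  have *: "G ` S \<subseteq> F ` S \<and> (\<forall>j. j \<notin> S \<longrightarrow> G j = F j) \<and>
      ((\<forall>j\<in>S. j \<in> F j) \<longrightarrow> (\<forall>j\<in>S. j \<in> G j))"
    using assms
  proof (induction rule: rtrancl_induct)
    case (step G H)
    then obtain i J where "H = (\<lambda>j. if j \<in> J \<inter> G i then G i else G j)" "i \<in> S" "J \<subseteq> S"
      unfolding partial_pivots_def by auto
    then show ?case using step.IH by auto
  qed auto
  show "G ` S \<subseteq> F ` S" using * by (rule conjunct1)
  show "j \<notin> S \<Longrightarrow> G j = F j" using * by blast
  show "(\<And>j. j \<in> S \<Longrightarrow> j \<in> F j) \<Longrightarrow> j \<in> S \<Longrightarrow> j \<in> G j" using * by meson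
qed

text \<open>The common column \<open>c\<close> may have entries outside \<open>S\<close>; these
  occur once the induction has passed to a subset of the vertices.\<close>

definition pure_blocks :: "'a set \<Rightarrow> nat \<Rightarrow> ('a \<Rightarrow> 'a set) \<Rightarrow> 'a set set \<Rightarrow> bool" where
  "pure_blocks S m F \<A> \<longleftrightarrow> finite \<A> \<and> disjoint \<A> \<and> \<Union>\<A> \<subseteq> S \<and>
     (\<forall>B\<in>\<A>. card B = m \<and> (\<exists>c. c \<inter> S = B \<and> (\<forall>a\<in>B. F a = c)))"

lemma pure_blocksD:
  assumes "pure_blocks S m F \<A>"
  shows "finite \<A>" "disjoint \<A>" "B \<in> \<A> \<Longrightarrow> B \<subseteq> S" "B \<in> \<A> \<Longrightarrow> card B = m"
    "B \<in> \<A> \<Longrightarrow> \<exists>c. c \<inter> S = B \<and> (\<forall>a\<in>B. F a = c)"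
  using assms unfolding pure_blocks_def by auto

lemma pure_blocks_cong:
  assumes "pure_blocks S m F \<A>" "\<And>a. a \<in> \<Union>\<A> \<Longrightarrow> G a = F a"
  shows "pure_blocks S m G \<A>"
proof -
  have "\<exists>c. c \<inter> S = B \<and> (\<forall>a\<in>B. G a = c)" if B: "B \<in> \<A>" for B
  proof -
    have "\<forall>a\<in>B. G a = F a" using assms(2) B by auto
    then show ?thesis using pure_blocksD(5)[OF assms(1) B] by simp
  qed
  then show ?thesis using pure_blocksD[OF assms(1)] unfolding pure_blocks_def by auto
qed

text \<open>If a column still has \<open>m\<close> entries in the remainder, copying it to these
  vertices makes them a new pure block. The remainder shrinks, since it loses the pivot
  vertex.\<close>

lemma extract_pure_blocks:
  fixes F :: "'a \<Rightarrow> 'a set"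
  assumes "finite S" "m > 0"
    and "\<And>j. j \<in> S \<Longrightarrow> j \<in> F j" "\<And>j. j \<in> S \<Longrightarrow> card (F j \<inter> S) \<le> m"
    and "pure_blocks S m F \<A>"
  shows "\<exists>G \<B>. (F, G) \<in> (partial_pivots S)\<^sup>* \<and> pure_blocks S m G \<B> \<and>
    (\<forall>j\<in>S - \<Union>\<B>. card (G j \<inter> (S - \<Union>\<B>)) < m)"
  using assms(3-5)
proof (induction "card (S - \<Union>\<A>)" arbitrary: F \<A> rule: less_induct)
  case less
  let ?R = "S - \<Union>\<A>"
  show ?case
  proof (cases "\<forall>j\<in>?R. card (F j \<inter> ?R) < m")
    case True
    then show ?thesis using less.prems by blast
  next
    case False
    then obtain i where i: "i \<in> S" "i \<notin> \<Union>\<A>" "card (F i \<inter> ?R) \<ge> m" by auto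
    have sub: "F i \<inter> ?R \<subseteq> F i \<inter> S" by auto
    have "card (F i \<inter> S) \<le> card (F i \<inter> ?R)" using less.prems(2)[OF i(1)] i(3) by simp
    \<comment> \<open>The weight bound \<open>m\<close> is used up inside \<open>?R\<close>, so the
      column avoids the earlier blocks.\<close>
    then have eq: "F i \<inter> ?R = F i \<inter> S"
      using card_seteq[OF _ sub] assms(1) by blast
    then have card_i: "card (F i \<inter> S) = m" using i less.prems(2)[OF i(1)] by simp
    define G where "G = (\<lambda>j. if j \<in> ?R \<inter> F i then F i else F j)"
    have FG: "(F, G) \<in> (partial_pivots S)\<^sup>*"
      unfolding G_def using partial_pivotsI[OF i(1), of ?R F] by blast
    note G = partial_pivots_rtrancl[OF FG]
    define \<B> where "\<B> = insert (F i \<inter> S) \<A>"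
    have "pure_blocks S m G \<A>"
      using less.prems(3) by (rule pure_blocks_cong) (auto simp: G_def)
    moreover have "F i \<inter> S \<inter> \<Union>\<A> = {}" using eq by auto
    moreover have "\<forall>a\<in>F i \<inter> S. G a = F i" using eq by (auto simp: G_def)
    ultimately have pure: "pure_blocks S m G \<B>"
      unfolding pure_blocks_def \<B>_def using card_i
      by (auto simp: disjoint_def)
    have "i \<in> S - \<Union>\<A>" "i \<notin> S - \<Union>\<B>" using i less.prems(1) by (auto simp: \<B>_def)
    then have "S - \<Union>\<B> \<subset> S - \<Union>\<A>" by (auto simp: \<B>_def)
    then have lt: "card (S - \<Union>\<B>) < card (S - \<Union>\<A>)"
      using assms(1) by (intro psubset_card_mono) auto
    have diag: "j \<in> G j" if "j \<in> S" for j using G(3) less.prems(1) that by auto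
    have wt: "card (G j \<inter> S) \<le> m" if "j \<in> S" for j
      using G(1) less.prems(2) that by auto
    obtain H \<C> where "(G, H) \<in> (partial_pivots S)\<^sup>*" "pure_blocks S m H \<C>"
      "\<forall>j\<in>S - \<Union>\<C>. card (H j \<inter> (S - \<Union>\<C>)) < m"
      using less.hyps[OF lt diag wt pure] by blast
    then show ?thesis using FG by (meson rtrancl_trans)
  qed
qed

text \<open>Each pure block may be toggled or not, independently of the others.\<close>

lemma pure_blocks_bound:
  assumes "pure_blocks S m F \<A>" "finite S" "m > 0"
    and Q: "\<And>v. v \<in> xspan (F ` S) \<Longrightarrow> card (v \<inter> S) \<le> Q"
    and "v \<in> xspan (F ` S)"
  shows "card (v \<inter> (S - \<Union>\<A>)) + (\<Sum>B\<in>\<A>. max (card (v \<inter> B)) (m - card (v \<inter> B))) \<le> Q"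
proof -
  \<comment> \<open>Stated for subfamilies \<open>\<D>\<close> and all \<open>v\<close>, so that
    blocks can be added one at a time.\<close>
  have "card (v \<inter> (S - \<Union>\<D>)) + (\<Sum>B\<in>\<D>. max (card (v \<inter> B)) (m - card (v \<inter> B))) \<le> Q"
    if "finite \<D>" "\<D> \<subseteq> \<A>" "v \<in> xspan (F ` S)" for \<D> v
    using that
  proof (induction arbitrary: v)
    case empty
    then show ?case using Q by simp
  next
    case (insert B \<D>)
    then have B: "B \<in> \<A>" by simp
    obtain c where c: "c \<inter> S = B" "\<forall>a\<in>B. F a = c" "card B = m"
      using pure_blocksD(4,5)[OF assms(1) B] by metis
    have disj: "B \<inter> B' = {}" if "B' \<in> \<D>" for B'
    proof -
      have "B' \<in> \<A>" "B \<noteq> B'" using that insert.hyps insert.prems(1) by auto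
      then show ?thesis using disjointD[OF pure_blocksD(2)[OF assms(1)] B] by simp
    qed
    have "finite B" using c assms(2) by auto
    obtain a where "a \<in> B" using c \<open>m > 0\<close> by (metis all_not_in_conv card.empty less_irrefl)
    \<comment> \<open>Adding the common column complements \<open>v\<close> on \<open>B\<close> and
      changes nothing else in \<open>S\<close>. The induction hypothesis for \<open>v\<close> and
      for \<open>w\<close> yields the two arguments of the maximum.\<close>
    define w where "w = sym_diff v c"
    have w: "w \<in> xspan (F ` S)"
      unfolding w_def using insert.prems(2) c \<open>a \<in> B\<close> by (intro xspan.add) auto
    have split: "card (z \<inter> (S - \<Union>\<D>)) = card (z \<inter> (S - \<Union>(insert B \<D>))) + card (z \<inter> B)" for z
    proof -
      have "z \<inter> (S - \<Union>\<D>) = (z \<inter> (S - \<Union>(insert B \<D>))) \<union> (z \<inter> B)"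
        using c(1) disj by blast
      moreover have "card \<dots> = card (z \<inter> (S - \<Union>(insert B \<D>))) + card (z \<inter> B)"
        using assms(2) \<open>finite B\<close> by (intro card_Un_disjoint) auto
      ultimately show ?thesis by simp
    qed
    have 1: "w \<inter> (S - \<Union>(insert B \<D>)) = v \<inter> (S - \<Union>(insert B \<D>))"
      using c(1) unfolding w_def by auto
    have 2: "w \<inter> B' = v \<inter> B'" if "B' \<in> \<D>" for B'
    proof -
      have "B' \<subseteq> S" using pure_blocksD(3)[OF assms(1)] insert.prems(1) that by blast
      then show ?thesis using disj[OF that] c(1) unfolding w_def by auto
    qed
    have 3: "card (w \<inter> B) = m - card (v \<inter> B)"
      unfolding w_def using c \<open>finite B\<close> card_sym_diff_subset[of B c v] by blast
    have "card (v \<inter> (S - \<Union>\<D>)) + (\<Sum>B\<in>\<D>. max (card (v \<inter> B)) (m - card (v \<inter> B))) \<le> Q"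
      using insert by simp
    moreover have "card (w \<inter> (S - \<Union>\<D>)) + (\<Sum>B\<in>\<D>. max (card (v \<inter> B)) (m - card (v \<inter> B))) \<le> Q"
      using insert.IH[OF _ w] insert.prems(1) by (simp add: 2)
    ultimately show ?case
      using insert.hyps unfolding split 1 3 by (auto simp: max_def)
  qed
  from this[OF pure_blocksD(1)[OF assms(1)] subset_refl assms(5)] show ?thesis .
qed

subsection \<open>Attaching pure blocks to copies of a smaller V\<close>

text \<open>Vertex \<open>y - 1\<close> of the \<open>u\<close>-th copy of \<open>V k\<close> is realised by \<open>f (u, y)\<close>.\<close>

definition V_copies :: "'a set \<Rightarrow> nat \<Rightarrow> nat \<Rightarrow> ('a \<Rightarrow> 'a set) \<Rightarrow> (nat \<times> nat \<Rightarrow> 'a) \<Rightarrow> bool" where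
  "V_copies S k q F f \<longleftrightarrow> bij_betw f ({..<q} \<times> {1..<2 ^ (k + 1)}) S \<and>
     (\<forall>u<q. \<forall>u'<q. \<forall>y\<in>{1..<2 ^ (k + 1)}. \<forall>y'\<in>{1..<2 ^ (k + 1)}.
        (f (u', y') \<in> F (f (u, y)) \<longleftrightarrow> u = u' \<and> bit y' (floor_log y)) \<and>
        (floor_log y = floor_log y' \<longrightarrow> F (f (u, y)) = F (f (u, y'))))"

lemma V_copies_bij: "V_copies S k q F f \<Longrightarrow> bij_betw f ({..<q} \<times> {1..<2 ^ (k + 1)}) S"
  unfolding V_copies_def by (rule conjunct1)

lemma V_copies_entry:
  assumes "V_copies S k q F f" "u < q" "u' < q"
    and "y \<in> {1..<2 ^ (k + 1)}" "y' \<in> {1..<2 ^ (k + 1)}"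
  shows "f (u', y') \<in> F (f (u, y)) \<longleftrightarrow> u = u' \<and> bit y' (floor_log y)"
  using assms(1)[unfolded V_copies_def, THEN conjunct2, rule_format, OF assms(2-5)]
  by (rule conjunct1)

lemma V_copies_same_column:
  assumes "V_copies S k q F f" "u < q" "y \<in> {1..<2 ^ (k + 1)}" "y' \<in> {1..<2 ^ (k + 1)}"
    and "floor_log y = floor_log y'"
  shows "F (f (u, y)) = F (f (u, y'))"
  using assms(1)[unfolded V_copies_def, THEN conjunct2, rule_format, OF assms(2,2-4)] assms(5)
  by simp

lemma sum_eq_lower_bound:
  fixes f :: "'b \<Rightarrow> nat"
  assumes "finite A" "\<And>x. x \<in> A \<Longrightarrow> h \<le> f x" "sum f A \<le> card A * h" "x \<in> A"
  shows "f x = h"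
proof -
  have "sum f A = f x + sum f (A - {x})" using assms by (simp add: sum.remove)
  moreover have "card (A - {x}) * h \<le> sum f (A - {x})"
    using sum_bounded_below[of "A - {x}" h f] assms by simp
  moreover have "card A * h = h + card (A - {x}) * h"
    by (simp flip: card_Suc_Diff1[OF assms(1,4)])
  ultimately show ?thesis using assms(2)[OF assms(4)] assms(3) by linarith
qed

lemma bit_inj_on_lt:
  assumes "(y::nat) div 2 ^ K = y' div 2 ^ K" "\<And>i. i < K \<Longrightarrow> bit y i = bit y' i"
  shows "y = y'"
proof -
  have "take_bit K y = take_bit K y'"
    using assms(2) by (intro bit_eqI) (auto simp: bit_take_bit_iff)
  then have "y mod 2 ^ K = y' mod 2 ^ K" by (simp add: take_bit_eq_mod)
  then show ?thesis using assms(1) by (metis div_mult_mod_eq)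
qed

lemma floor_log_less:
  assumes "y \<in> {1..<2 ^ K}" shows "floor_log y < K"
proof -
  have "2 ^ floor_log y \<le> y" using assms by (intro floor_log_exp2_le) auto
  also have "y < 2 ^ K" using assms by auto
  finally show ?thesis by (simp only: power_strict_increasing_iff)
qed

text \<open>Each copy of \<open>V k\<close> is matched with one pure block, which becomes its top
  block. The matching is forced because sums meeting every copy attain equality in
  \<open>bound\<close>.\<close>

lemma V_copies_step:
  fixes F :: "'a \<Rightarrow> 'a set"
  assumes "finite S" and pure: "pure_blocks S (2 ^ Suc k) F \<A>" and card_A: "card \<A> = q"
    and wt: "\<And>j. j \<in> S \<Longrightarrow> card (F j \<inter> S) \<le> 2 ^ Suc k"
    and bound: "\<And>v. v \<in> xspan (F ` S) \<Longrightarrow> card (v \<inter> (S - \<Union>\<A>)) +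
      (\<Sum>B\<in>\<A>. max (card (v \<inter> B)) (2 ^ Suc k - card (v \<inter> B))) \<le> q * 2 ^ Suc k"
    and copies: "V_copies (S - \<Union>\<A>) k q F g"
  shows "\<exists>f. V_copies S (Suc k) q F f"
proof -
  \<comment> \<open>\<open>K\<close> is the number of generators of a copy; a pure block has
    \<open>2 ^ K\<close> vertices, one for each pattern of generators.\<close>
  define K where "K = Suc k"
  define h :: nat where "h = 2 ^ k"
  define R where "R = S - \<Union>\<A>"
  define A where "A = \<Union>\<A>"
  \<comment> \<open>The label \<open>2 ^ i\<close> represents all labels with leading bit
    \<open>i\<close>, which share one column.\<close>
  define c where "c u i = F (g (u, 2 ^ i))" for u i
  note pure_D = pure_blocksD[OF pure]
  have two_h: "2 ^ Suc k = 2 * h" "2 ^ K = 2 * h" and h_pos: "h > 0"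
    by (simp_all add: h_def K_def)
  have finA: "finite A" "finite R" and A_sub: "A \<subseteq> S"
    using assms(1) pure_D(3) unfolding A_def R_def by (auto intro: finite_subset)
  have finB: "finite B" if "B \<in> \<A>" for B
    using assms(1) pure_D(3)[OF that] finite_subset by blast
  have gbij: "bij_betw g ({..<q} \<times> {1..<2 ^ K}) R"
    using V_copies_bij[OF copies] unfolding R_def K_def by simp
  have gent: "g (u', y') \<in> F (g (u, y)) \<longleftrightarrow> u = u' \<and> bit y' (floor_log y)"
    if "u < q" "u' < q" "y \<in> {1..<2 ^ K}" "y' \<in> {1..<2 ^ K}" for u u' y y'
    using V_copies_entry[OF copies that(1,2)] that(3,4) unfolding K_def by simp
  have pow_in: "2 ^ i \<in> {1..<2 ^ K :: nat}" if "i < K" for i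
    using that by simp
  have gcol: "F (g (u, y)) = c u (floor_log y)" if "u < q" "y \<in> {1..<2 ^ K}" for u y
  proof -
    have "2 ^ floor_log y \<in> {1..<2 ^ K :: nat}" using pow_in floor_log_less[OF that(2)] by blast
    moreover have "floor_log y = floor_log (2 ^ floor_log y)" by simp
    ultimately show ?thesis
      using V_copies_same_column[OF copies that(1), of y "2 ^ floor_log y"] that(2)
      unfolding K_def c_def by simp
  qed
  have cent: "g (u', y') \<in> c u i \<longleftrightarrow> u = u' \<and> bit y' i"
    if "u < q" "u' < q" "i < K" "y' \<in> {1..<2 ^ K}" for u u' i y'
    using gent[OF that(1,2) pow_in[OF that(3)] that(4)] by (simp add: c_def)
  have g_in: "g (u, y) \<in> R" if "u < q" "y \<in> {1..<2 ^ K}" for u y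
    using gbij that by (auto simp: bij_betw_def)
  have c_in: "c u i \<in> F ` S" if "u < q" "i < K" for u i
    using g_in[OF that(1) pow_in[OF that(2)]] unfolding c_def R_def by auto
  have R_elem: "\<exists>u y. u < q \<and> y \<in> {1..<2 ^ K} \<and> x = g (u, y)" if "x \<in> R" for x
  proof -
    have "x \<in> g ` ({..<q} \<times> {1..<2 ^ K})" using gbij that by (simp add: bij_betw_def)
    then obtain u y where "u < q" "y \<in> {1..<2 ^ K}" "x = g (u, y)"
      unfolding image_iff lessThan_iff by auto
    then show ?thesis by blast
  qed

  \<comment> \<open>On its own copy the sum is a nonzero linear form in the bits of the label, and
    it vanishes on the other copies.\<close>
  have wtR: "card (toggle_sum (c u) I \<inter> R) = h" if u: "u < q" and I: "I \<subseteq> {..<K}" "I \<noteq> {}" for u I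
  proof -
    have mem: "g (u', y) \<in> toggle_sum (c u) I \<longleftrightarrow> u' = u \<and> odd (card {i \<in> I. bit y i})"
      if "u' < q" "y \<in> {1..<2 ^ K}" for u' y
    proof -
      have "{i \<in> I. g (u', y) \<in> c u i} = (if u = u' then {i \<in> I. bit y i} else {})"
        using cent[OF u that(1) _ that(2)] I by auto
      then show ?thesis by (simp add: toggle_sum_def)
    qed
    have "toggle_sum (c u) I \<inter> R = (\<lambda>y. g (u, y)) ` {y \<in> {1..<2 ^ K}. odd (card {i \<in> I. bit y i})}"
    proof (intro equalityI subsetI)
      fix x assume x: "x \<in> toggle_sum (c u) I \<inter> R"
      then obtain u' y where "u' < q" "y \<in> {1..<2 ^ K}" "x = g (u', y)" using R_elem by blast
      then show "x \<in> (\<lambda>y. g (u, y)) ` {y \<in> {1..<2 ^ K}. odd (card {i \<in> I. bit y i})}"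
        using mem x by auto
    next
      fix x assume "x \<in> (\<lambda>y. g (u, y)) ` {y \<in> {1..<2 ^ K}. odd (card {i \<in> I. bit y i})}"
      then show "x \<in> toggle_sum (c u) I \<inter> R" using mem[OF u] g_in[OF u] by auto
    qed
    moreover have "inj_on (\<lambda>y. g (u, y)) {y \<in> {1..<2 ^ K}. odd (card {i \<in> I. bit y i})}"
      using gbij u by (auto simp: bij_betw_def inj_on_def)
    ultimately show ?thesis
      using card_odd_bits[OF I] by (simp add: card_image h_def K_def)
  qed

  \<comment> \<open>A valid choice takes a nonzero sum from every copy, so that \<open>vec\<close>
    has the largest possible weight \<open>q * h\<close> on \<open>R\<close>.\<close>
  define valid where "valid II \<longleftrightarrow> (\<forall>u<q. II u \<subseteq> {..<K} \<and> II u \<noteq> {})" for II :: "nat \<Rightarrow> nat set"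
  define vec where "vec II = toggle_sum (\<lambda>(u, i). c u i) (Sigma {..<q} II)" for II
  have fin_valid: "finite (II u)" if "valid II" "u \<in> {..<q}" for II u
    using that finite_subset[of "II u" "{..<K}"] by (simp add: valid_def)
  have valid_lt: "i < K" if "valid II" "u < q" "i \<in> II u" for II u i
    using that unfolding valid_def by blast
  have half: "card (vec II \<inter> B) = h" if II: "valid II" and B: "B \<in> \<A>" for II B
  proof -
    have "card (vec II \<inter> R) = (\<Sum>u<q. card (toggle_sum (c u) (II u) \<inter> R))"
      unfolding vec_def
    proof (rule card_toggle_sum_Sigma)
      fix x u u' i i'
      assume *: "x \<in> R" "u \<in> {..<q}" "u' \<in> {..<q}" "u \<noteq> u'" "i \<in> II u" "i' \<in> II u'" "x \<in> c u i"
      have "i < K" "i' < K" using * valid_lt[OF II] by simp_all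
      moreover obtain u0 y where "u0 < q" "y \<in> {1..<2 ^ K}" "x = g (u0, y)" using R_elem * by blast
      ultimately show "x \<notin> c u' i'" using * cent by auto
    qed (use finA fin_valid[OF II] in auto)
    also have "\<dots> = q * h" using wtR II by (simp add: valid_def)
    finally have R_wt: "card (vec II \<inter> R) = q * h" .
    have "vec II \<in> xspan (F ` S)"
      unfolding vec_def
    proof (rule toggle_sum_in_xspan)
      show "finite (Sigma {..<q} II)" using fin_valid[OF II] by (intro finite_SigmaI) auto
      show "(\<lambda>(u, i). c u i) ` Sigma {..<q} II \<subseteq> F ` S"
        using c_in valid_lt[OF II] by auto
    qed
    \<comment> \<open>With \<open>q * h\<close> spent on \<open>R\<close>, only \<open>q * h\<close>
      is left for the \<open>q\<close> blocks. Each maximum is at least \<open>h\<close>, so each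
      equals \<open>h\<close>.\<close>
    from bound[OF this] have "(\<Sum>B\<in>\<A>. max (card (vec II \<inter> B)) (2 * h - card (vec II \<inter> B))) \<le> card \<A> * h"
      using R_wt card_A unfolding R_def two_h by (simp add: mult.commute)
    then have "max (card (vec II \<inter> B)) (2 * h - card (vec II \<inter> B)) = h"
      using sum_eq_lower_bound[OF pure_D(1) _ _ B, where h = h and f =
        "\<lambda>B. max (card (vec II \<inter> B)) (2 * h - card (vec II \<inter> B))"] by simp
    then show ?thesis by (auto simp: max_def split: if_splits)
  qed

  have sum_A: "(\<Sum>B\<in>\<A>. card (v \<inter> B)) = card (v \<inter> A)" for v
  proof -
    have "v \<inter> A = (\<Union>B\<in>\<A>. v \<inter> B)" unfolding A_def by auto
    moreover have "card \<dots> = (\<Sum>B\<in>\<A>. card (v \<inter> B))"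
    proof (rule card_UN_disjoint)
      show "\<forall>B\<in>\<A>. \<forall>B'\<in>\<A>. B \<noteq> B' \<longrightarrow> v \<inter> B \<inter> (v \<inter> B') = {}"
        using disjointD[OF pure_D(2)] by blast
    qed (use pure_D(1) finB in auto)
    ultimately show ?thesis by simp
  qed

  \<comment> \<open>Of the total weight at most \<open>2 * h\<close>, exactly \<open>h\<close> lies
    on \<open>R\<close>.\<close>
  have wtA: "card (c u i \<inter> A) \<le> h" if ui: "u < q" "i < K" for u i
  proof -
    obtain j where "j \<in> S" "c u i = F j" using c_in[OF ui] by auto
    then have "card (c u i \<inter> S) \<le> 2 * h" using wt two_h by simp
    moreover have "c u i \<inter> S = (c u i \<inter> R) \<union> (c u i \<inter> A)"
      using A_sub unfolding R_def A_def by auto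
    moreover have "card ((c u i \<inter> R) \<union> (c u i \<inter> A)) = card (c u i \<inter> R) + card (c u i \<inter> A)"
      using finA by (intro card_Un_disjoint) (auto simp: R_def A_def)
    moreover have "card (c u i \<inter> R) = h" using wtR[of u "{i}"] ui by simp
    ultimately show ?thesis by simp
  qed

  have disj: "c u i \<inter> c u' i' \<inter> A = {}"
    if u: "u < q" "u' < q" "u \<noteq> u'" and i: "i < K" "i' < K" for u u' i i'
  proof -
    \<comment> \<open>One generator is taken from each copy, with \<open>0\<close> elsewhere only to
      make the choice valid. Together these columns weigh at most \<open>q * h\<close> on
      \<open>A\<close>, which is what their sum weighs by \<open>half\<close>, so no two of them
      overlap there.\<close>
    define ii where "ii w = (if w = u then i else if w = u' then i' else 0)" for w
    define II where "II w = {ii w}" for w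
    have ii: "ii w < K" for w using i by (auto simp: ii_def K_def)
    then have II: "valid II" by (auto simp: valid_def II_def)
    have "(\<Sum>p\<in>Sigma {..<q} II. card ((case p of (u, i) \<Rightarrow> c u i) \<inter> A)) =
        (\<Sum>w<q. \<Sum>i\<in>II w. card (c w i \<inter> A))"
      using fin_valid[OF II] by (subst sum.Sigma) (auto simp: case_prod_beta)
    also have "\<dots> \<le> (\<Sum>w<q. h)"
      using wtA ii by (intro sum_mono) (auto simp: II_def)
    also have "\<dots> = (\<Sum>B\<in>\<A>. card (vec II \<inter> B))" using half[OF II] card_A by simp
    finally have le: "(\<Sum>p\<in>Sigma {..<q} II. card ((case p of (u, i) \<Rightarrow> c u i) \<inter> A)) \<le>
        card (toggle_sum (\<lambda>(u, i). c u i) (Sigma {..<q} II) \<inter> A)"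
      by (simp only: sum_A vec_def)
    have "(case (u, i) of (u, i) \<Rightarrow> c u i) \<inter> (case (u', i') of (u, i) \<Rightarrow> c u i) \<inter> A = {}"
      by (rule toggle_sum_tight_disjoint[OF _ _ le])
        (use fin_valid[OF II] finA u in \<open>auto simp: II_def ii_def\<close>)
    then show ?thesis by simp
  qed

  have dsum: "(\<Sum>u<q. card (toggle_sum (c u) (II u) \<inter> B)) = h" if II: "valid II" and B: "B \<in> \<A>" for II B
  proof -
    have "card (vec II \<inter> B) = (\<Sum>u<q. card (toggle_sum (c u) (II u) \<inter> B))"
      unfolding vec_def
    proof (rule card_toggle_sum_Sigma)
      fix x u u' i i'
      assume *: "x \<in> B" "u \<in> {..<q}" "u' \<in> {..<q}" "u \<noteq> u'" "i \<in> II u" "i' \<in> II u'" "x \<in> c u i"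
      have "i < K" "i' < K" using * valid_lt[OF II] by simp_all
      then have "c u i \<inter> c u' i' \<inter> A = {}" using disj * by simp
      then show "x \<notin> c u' i'" using * B unfolding A_def by auto
    qed (use finB[OF B] fin_valid[OF II] in auto)
    then show ?thesis using half[OF II B] by simp
  qed

  define d where "d u B = card (c u 0 \<inter> B)" for u B
  have v0: "valid (\<lambda>_. {0})" by (simp add: valid_def K_def)
  have d_sum: "(\<Sum>u<q. d u B) = h" if "B \<in> \<A>" for B
    using dsum[OF v0 that] by (simp add: d_def)
  have dconst: "card (toggle_sum (c u) I \<inter> B) = d u B"
    if u: "u < q" and I: "I \<subseteq> {..<K}" "I \<noteq> {}" and B: "B \<in> \<A>" for u I B
  proof -
    \<comment> \<open>Only the choice in copy \<open>u\<close> varies while the total stays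
      \<open>h\<close>, so the share of \<open>u\<close> cannot depend on \<open>I\<close>.\<close>
    define II where "II = (\<lambda>w. if w = u then I else {0})"
    have "valid II" using I by (simp add: valid_def II_def K_def)
    from dsum[OF this B] have "card (toggle_sum (c u) I \<inter> B) + (\<Sum>w\<in>{..<q} - {u}. d w B) = h"
      using u by (subst (asm) sum.remove[of _ u]) (auto simp: II_def d_def)
    moreover have "d u B + (\<Sum>w\<in>{..<q} - {u}. d w B) = h"
      using d_sum[OF B] u by (subst (asm) sum.remove[of _ u]) auto
    ultimately show ?thesis by simp
  qed
  have d_le: "d u B \<le> h" if "u < q" "B \<in> \<A>" for u B
    using d_sum[OF that(2)] member_le_sum[of u "{..<q}" "\<lambda>u. d u B"] that(1) by simp
  have patterns: "2 * int h * int (card {x \<in> B. {i \<in> {..<K}. x \<in> c u i} = P}) =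
      2 * int h + (2 * int h - 2 * int (d u B)) * ((if P = {} then 2 * int h else 0) - 1)"
    if "u < q" "B \<in> \<A>" "P \<subseteq> {..<K}" for u B P
    using constant_weight_patterns[OF finB[OF that(2)] _ dconst[OF that(1) _ _ that(2)] that(3)]
      pure_D(4)[OF that(2)] unfolding h_def K_def by simp
  have d_cases: "d u B = 0 \<or> d u B = h" if "u < q" "B \<in> \<A>" for u B
  proof -
    \<comment> \<open>Any nonempty pattern would serve. The inversion formula then reads
      \<open>d u B = h * N\<close>, and \<open>d u B\<close> is at most \<open>h\<close>.\<close>
    define N where "N = card {x \<in> B. {i \<in> {..<K}. x \<in> c u i} = {0}}"
    have "2 * int h * int N = 2 * int (d u B)"
      using patterns[OF that, of "{0}"] by (simp add: N_def K_def)
    then have "d u B = h * N" by (metis mult.assoc mult_left_cancel of_nat_eq_iff of_nat_mult zero_neq_numeral)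
    then show ?thesis using d_le[OF that] h_pos by (cases N) auto
  qed
  have "\<exists>u<q. d u B = h" if "B \<in> \<A>" for B
  proof (rule ccontr)
    assume "\<not> ?thesis"
    then have "(\<Sum>u<q. d u B) = 0" using d_cases that by auto
    then show False using d_sum[OF that] h_pos by simp
  qed
  then obtain \<tau> where \<tau>: "\<And>B. B \<in> \<A> \<Longrightarrow> \<tau> B < q \<and> d (\<tau> B) B = h" by metis
  \<comment> \<open>Two blocks assigned to one copy would give its generator \<open>0\<close> weight
    \<open>2 * h\<close> on \<open>A\<close>, against \<open>wtA\<close>.\<close>
  have "inj_on \<tau> \<A>"
  proof (rule inj_onI, rule ccontr)
    fix B B' assume *: "B \<in> \<A>" "B' \<in> \<A>" "\<tau> B = \<tau> B'" "B \<noteq> B'"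
    have "h + h = (\<Sum>D\<in>{B, B'}. d (\<tau> B) D)" using * \<tau>[of B] \<tau>[of B'] by simp
    also have "\<dots> \<le> (\<Sum>D\<in>\<A>. d (\<tau> B) D)" using * pure_D(1) by (intro sum_mono2) auto
    also have "\<dots> = card (c (\<tau> B) 0 \<inter> A)" unfolding d_def by (rule sum_A)
    also have "\<dots> \<le> h" using wtA \<tau>[OF *(1)] by (simp add: K_def)
    finally show False using h_pos by simp
  qed
  then have \<tau>_bij: "bij_betw \<tau> \<A> {..<q}"
    using \<tau> card_A pure_D(1) unfolding bij_betw_def
    by (metis card_image card_lessThan card_subset_eq finite_lessThan image_subsetI lessThan_iff)
  define \<sigma> where "\<sigma> = inv_into \<A> \<tau>"
  have \<sigma>_bij: "bij_betw \<sigma> {..<q} \<A>" unfolding \<sigma>_def by (rule bij_betw_inv_into[OF \<tau>_bij])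
  have \<sigma>_in: "\<sigma> u \<in> \<A>" if "u < q" for u using \<sigma>_bij that by (auto simp: bij_betw_def)
  have \<tau>\<sigma>: "\<tau> (\<sigma> u) = u" if "u < q" for u
    unfolding \<sigma>_def using bij_betw_inv_into_right[OF \<tau>_bij] that by simp
  have d\<sigma>: "d u (\<sigma> u) = h" if "u < q" for u
    using \<tau>[OF \<sigma>_in[OF that]] \<tau>\<sigma>[OF that] by simp
  \<comment> \<open>Copy \<open>u'\<close> already uses the whole total \<open>h\<close> on its
    block, which leaves 0 for every other copy.\<close>
  have other: "c u i \<inter> \<sigma> u' = {}" if u: "u < q" "u' < q" "u \<noteq> u'" and i: "i < K" for u u' i
  proof -
    have "d u (\<sigma> u') + d u' (\<sigma> u') \<le> (\<Sum>w<q. d w (\<sigma> u'))"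
      using u sum_mono2[of "{..<q}" "{u, u'}" "\<lambda>w. d w (\<sigma> u')"] by simp
    then have "d u (\<sigma> u') = 0" using d_sum[OF \<sigma>_in[OF u(2)]] d\<sigma>[OF u(2)] by simp
    then have "card (c u i \<inter> \<sigma> u') = 0"
      using dconst[OF u(1) _ _ \<sigma>_in[OF u(2)], of "{i}"] i by simp
    then show ?thesis using finB[OF \<sigma>_in[OF u(2)]] by simp
  qed
  \<comment> \<open>For \<open>d = h\<close> the factor \<open>2 * h - 2 * d\<close> vanishes, so
    the empty pattern obeys the same count as the others.\<close>
  have one: "card {x \<in> \<sigma> u. {i \<in> {..<K}. x \<in> c u i} = P} = 1" if "u < q" "P \<subseteq> {..<K}" for u P
  proof -
    have "2 * int h * int (card {x \<in> \<sigma> u. {i \<in> {..<K}. x \<in> c u i} = P}) = 2 * int h * 1"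
      using patterns[OF that(1) \<sigma>_in[OF that(1)] that(2)] d\<sigma>[OF that(1)] by simp
    then show ?thesis using h_pos by simp
  qed
  have "\<exists>x. x \<in> \<sigma> u \<and> {i \<in> {..<K}. x \<in> c u i} = {i \<in> {..<K}. bit (y::nat) i}" if "u < q" for u y
  proof -
    have "card {x \<in> \<sigma> u. {i \<in> {..<K}. x \<in> c u i} = {i \<in> {..<K}. bit y i}} = 1"
      by (rule one[OF that]) auto
    then have "{x \<in> \<sigma> u. {i \<in> {..<K}. x \<in> c u i} = {i \<in> {..<K}. bit y i}} \<noteq> {}"
      by (metis card.empty zero_neq_one)
    then show ?thesis by blast
  qed
  then obtain e where e: "\<And>u y. u < q \<Longrightarrow> e u y \<in> \<sigma> u \<and>
      {i \<in> {..<K}. e u y \<in> c u i} = {i \<in> {..<K}. bit (y::nat) i}" by metis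
  have e_bit: "e u y \<in> c u i \<longleftrightarrow> bit y i" if "u < q" "i < K" for u i y
    using e[OF that(1), of y] that(2) by blast

  \<comment> \<open>These are the labels of the top block. They all have leading bit
    \<open>K\<close>, so the low \<open>K\<close> bits, that is the pattern, determine the
    label.\<close>
  let ?Y = "{2 ^ K..<2 ^ (K + 1)} :: nat set"
  have top: "y div 2 ^ K = 1" if "y \<in> ?Y" for y using that by (intro div_nat_eqI) auto
  have e_inj: "inj_on (e u) ?Y" if "u < q" for u
  proof (rule inj_onI)
    fix y y' assume *: "y \<in> ?Y" "y' \<in> ?Y" "e u y = e u y'"
    show "y = y'"
    proof (rule bit_inj_on_lt[of _ K])
      show "y div 2 ^ K = y' div 2 ^ K" using top * by simp
      show "bit y i = bit y' i" if "i < K" for i using e_bit[OF \<open>u < q\<close> that] * by metis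
    qed
  qed
  have e_img: "e u ` ?Y = \<sigma> u" if "u < q" for u
  proof (rule card_subset_eq)
    show "finite (\<sigma> u)" using finB \<sigma>_in that by blast
    show "e u ` ?Y \<subseteq> \<sigma> u" using e[OF that] by blast
    show "card (e u ` ?Y) = card (\<sigma> u)"
      using card_image[OF e_inj[OF that]] pure_D(4)[OF \<sigma>_in[OF that]] by (simp add: K_def)
  qed
  have \<sigma>_disj: "\<sigma> u \<inter> \<sigma> u' = {}" if "u < q" "u' < q" "u \<noteq> u'" for u u'
  proof -
    have "\<sigma> u \<noteq> \<sigma> u'" using \<tau>\<sigma> that by metis
    then show ?thesis using disjointD[OF pure_D(2)] \<sigma>_in that by blast
  qed
  have e_bij: "bij_betw (\<lambda>(u, y). e u y) ({..<q} \<times> ?Y) A"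
    unfolding bij_betw_def
  proof
    show "inj_on (\<lambda>(u, y). e u y) ({..<q} \<times> ?Y)"
    proof (rule inj_onI)
      fix p p' assume p: "p \<in> {..<q} \<times> ?Y" "p' \<in> {..<q} \<times> ?Y"
        "(case p of (u, y) \<Rightarrow> e u y) = (case p' of (u, y) \<Rightarrow> e u y)"
      obtain u y u' y' where pp: "p = (u, y)" "p' = (u', y')" by (metis surj_pair)
      have *: "u < q" "u' < q" "y \<in> ?Y" "y' \<in> ?Y" "e u y = e u' y'" using p unfolding pp by auto
      have "u = u'"
      proof (rule ccontr)
        assume "u \<noteq> u'"
        then have "\<sigma> u \<inter> \<sigma> u' = {}" using \<sigma>_disj * by simp
        moreover have "e u y \<in> \<sigma> u" "e u' y' \<in> \<sigma> u'" using e *(1,2) by blast+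
        ultimately show False using *(5) by auto
      qed
      then show "p = p'" using inj_onD[OF e_inj[OF *(1)] _ *(3,4)] *(5) unfolding pp by simp
    qed
    have "(\<lambda>(u, y). e u y) ` ({..<q} \<times> ?Y) = (\<Union>u<q. e u ` ?Y)" by auto
    also have "\<dots> = (\<Union>u<q. \<sigma> u)" using e_img by simp
    also have "\<dots> = A" using \<sigma>_bij unfolding A_def bij_betw_def by simp
    finally show "(\<lambda>(u, y). e u y) ` ({..<q} \<times> ?Y) = A" .
  qed

  define f where "f p = (if snd p < 2 ^ K then g p else e (fst p) (snd p))" for p
  have f_low: "f (u, y) = g (u, y)" if "y < 2 ^ K" for u y using that by (simp add: f_def)
  have f_high: "f (u, y) = e u y" if "\<not> y < 2 ^ K" for u y using that by (simp add: f_def)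
  have "bij_betw f ({..<q} \<times> {1..<2 ^ K} \<union> {..<q} \<times> ?Y) (R \<union> A)"
  proof (rule bij_betw_combine)
    show "bij_betw f ({..<q} \<times> {1..<2 ^ K}) R"
      using gbij by (rule bij_betw_cong[THEN iffD1, rotated]) (auto simp: f_def)
    show "bij_betw f ({..<q} \<times> ?Y) A"
      using e_bij by (rule bij_betw_cong[THEN iffD1, rotated]) (auto simp: f_def)
    show "R \<inter> A = {}" unfolding R_def A_def by auto
  qed
  moreover have "{1..<2 ^ K} \<union> ?Y = {1..<2 ^ (K + 1)}" by (rule ivl_disj_un) auto
  then have "{..<q} \<times> {1..<2 ^ K} \<union> {..<q} \<times> ?Y = {..<q} \<times> {1..<2 ^ (K + 1)}" by blast
  moreover have "R \<union> A = S" using A_sub unfolding R_def A_def by auto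
  ultimately have f_bij: "bij_betw f ({..<q} \<times> {1..<2 ^ (K + 1)}) S" by metis

  have fl_high: "floor_log y = K" if "\<not> y < 2 ^ K" "y \<in> {1..<2 ^ (K + 1)}" for y
    using that by (intro floor_log_eqI) auto
  have fl_low: "floor_log y < K" if "y < 2 ^ K" "y \<in> {1..<2 ^ (K + 1)}" for y
    using that by (intro floor_log_less) auto
  have high_col: "F (e u y) \<inter> S = \<sigma> u" "F (e u y) = F (e u y')" if "u < q" for u y y'
  proof -
    have "e u y \<in> \<sigma> u" "e u y' \<in> \<sigma> u" using e that by blast+
    then show "F (e u y) \<inter> S = \<sigma> u" "F (e u y) = F (e u y')"
      using pure_D(5)[OF \<sigma>_in[OF that]] by metis+
  qed
  have e_S: "e u y \<in> A" "e u y \<in> S" if "u < q" for u y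
    using e[OF that, of y] \<sigma>_in[OF that] A_sub unfolding A_def by blast+
  have entry: "f (u', y') \<in> F (f (u, y)) \<longleftrightarrow> u = u' \<and> bit y' (floor_log y)"
    if u: "u < q" "u' < q" and y: "y \<in> {1..<2 ^ (K + 1)}" "y' \<in> {1..<2 ^ (K + 1)}" for u u' y y'
  proof (cases "y < 2 ^ K")
    case True
    then have Fc: "F (f (u, y)) = c u (floor_log y)" and lt: "floor_log y < K"
      using gcol[OF u(1)] y fl_low by (auto simp: f_low)
    show ?thesis
    proof (cases "y' < 2 ^ K")
      case True
      then show ?thesis using cent[OF u lt, of y'] y(2) unfolding Fc by (simp add: f_low)
    next
      case False
      then show ?thesis
        using e_bit[OF u(1) lt] other[OF u _ lt] e[OF u(2), of y'] unfolding Fc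
        by (cases "u = u'") (auto simp: f_high)
    qed
  next
    case False
    then have Fy: "F (f (u, y)) \<inter> S = \<sigma> u" and fl: "floor_log y = K"
      using high_col(1)[OF u(1)] fl_high y by (auto simp: f_high)
    show ?thesis
    proof (cases "y' < 2 ^ K")
      case True
      then have "f (u', y') \<in> R" using g_in[OF u(2)] y(2) by (simp add: f_low)
      moreover have "\<sigma> u \<subseteq> A" using \<sigma>_in[OF u(1)] unfolding A_def by blast
      ultimately have "f (u', y') \<notin> F (f (u, y))" using Fy unfolding R_def A_def by blast
      moreover have "\<not> bit y' K" using True by (simp add: bit_iff_odd)
      ultimately show ?thesis by (simp add: fl)
    next
      case False
      then have "f (u', y') \<in> S" "f (u', y') \<in> \<sigma> u'" using e_S[OF u(2)] e[OF u(2)] by (simp_all add: f_high)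
      then have "f (u', y') \<in> F (f (u, y)) \<longleftrightarrow> u = u'"
        using Fy \<sigma>_disj[OF u] by blast
      moreover have "bit y' K" using top[of y'] False y(2) by (simp add: bit_iff_odd)
      ultimately show ?thesis by (simp add: fl)
    qed
  qed
  have same: "F (f (u, y)) = F (f (u, y'))"
    if u: "u < q" and y: "y \<in> {1..<2 ^ (K + 1)}" "y' \<in> {1..<2 ^ (K + 1)}"
      and eq: "floor_log y = floor_log y'" for u y y'
  proof (cases "y < 2 ^ K")
    case True
    then have "y' < 2 ^ K" using fl_low fl_high y eq by (metis less_irrefl)
    then show ?thesis using True gcol[OF u, of y] gcol[OF u, of y'] y eq by (simp add: f_low)
  next
    case False
    then have "\<not> y' < 2 ^ K" using fl_low fl_high y eq by (metis less_irrefl)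
    then show ?thesis using False high_col(2)[OF u] by (simp add: f_high)
  qed
  have "V_copies S K q F f"
    unfolding V_copies_def using f_bij entry same by blast
  then show ?thesis unfolding K_def by blast
qed

subsection \<open>The induction\<close>

lemma a_seq_pos: "n \<ge> 1 \<Longrightarrow> a_seq n \<ge> 1"
  by (subst a_seq.simps) (auto simp: Suc_le_eq)

text \<open>For \<open>p = 2 * 2 ^ k - 1\<close> the period of \<open>U\<close> in its first
  argument is \<open>p\<close> itself. Each of \<open>s\<close> full periods contributes
  \<open>2 ^ k\<close>, and the nonempty rest at least 1.\<close>

lemma U_ge:
  assumes "n = s * (2 * 2 ^ k - 1) + r" "r \<ge> 1"
  shows "s * 2 ^ k + 1 \<le> U n (2 * 2 ^ k - 1)"
proof -
  obtain g where g: "(2::nat) ^ k = Suc g" by (cases "(2::nat) ^ k") auto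
  have fl: "floor_log (2 * 2 ^ k - 1) = k" by (intro floor_log_eqI) (simp_all add: g)
  have pos: "2 * 2 ^ k - 1 > (0::nat)" by (simp add: g)
  have N: "2 ^ (k + 1) - 1 = 2 * 2 ^ k - (1::nat)" by simp
  have "s * (2 * 2 ^ k - 1) \<le> n - 1" using assms by simp
  then have "s \<le> (n - 1) div (2 * 2 ^ k - 1)" using pos by (simp add: less_eq_div_iff_mult_less_eq)
  then have "s * 2 ^ k \<le> (n - 1) div (2 * 2 ^ k - 1) * 2 ^ k" by (rule mult_le_mono1)
  moreover have "1 \<le> a_seq ((n - 1) mod (2 * 2 ^ k - 1) + 1)" by (rule a_seq_pos) simp
  ultimately show ?thesis unfolding U_def Let_def fl N by (rule add_mono)
qed

text \<open>The map \<open>b\<close> translates row indices to vertices, so the lemma serves an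
  enumerated vertex set as well as \<open>{..<n}\<close> itself.\<close>

lemma mult_mat_vec_toggle_sum:
  fixes W :: "bit mat"
  assumes "\<And>i j. i < nr \<Longrightarrow> j < nc \<Longrightarrow> W $$ (i, j) = of_bool (b i \<in> F j)"
    and "W \<in> carrier_mat nr nc" "x \<in> carrier_vec nc"
  shows "i < nr \<Longrightarrow> (W *\<^sub>v x) $ i = of_bool (b i \<in> toggle_sum F {j \<in> {..<nc}. x $ j = 1})"
proof -
  assume i: "i < nr"
  have "(W *\<^sub>v x) $ i = (\<Sum>j\<in>{..<nc}. W $$ (i, j) * x $ j)"
    using assms(2,3) i by (auto simp: scalar_prod_def lessThan_atLeast0 intro!: sum.cong)
  also have "\<dots> = (\<Sum>j\<in>{..<nc}. if x $ j = 1 \<and> b i \<in> F j then 1 else 0)"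
    using assms(1)[OF i] by (intro sum.cong) auto
  also have "\<dots> = of_nat (card {j \<in> {..<nc}. x $ j = 1 \<and> b i \<in> F j})"
    by (simp flip: sum.inter_filter)
  also have "{j \<in> {..<nc}. x $ j = 1 \<and> b i \<in> F j} = {j \<in> {j \<in> {..<nc}. x $ j = 1}. b i \<in> F j}"
    by auto
  also have "(of_nat (card \<dots>) :: bit) = of_bool (b i \<in> toggle_sum F {j \<in> {..<nc}. x $ j = 1})"
  proof -
    have "(of_nat n :: bit) = of_bool (odd n)" for n by (induction n) auto
    then show ?thesis by (simp add: toggle_sum_def)
  qed
  finally show "(W *\<^sub>v x) $ i = of_bool (b i \<in> toggle_sum F {j \<in> {..<nc}. x $ j = 1})" .
qed

text \<open>After an enumeration of \<open>R\<close>, the submatrix on \<open>R\<close> is a wiring,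
  and its maximum is at least the minimum \<open>mu n p\<close>. A maximising vector gives a sum of
  the full columns.\<close>

lemma mu_attained:
  assumes "finite R" "card R = n" "p \<ge> 1"
    and diag: "\<And>j. j \<in> R \<Longrightarrow> j \<in> F j" and wt: "\<And>j. j \<in> R \<Longrightarrow> card (F j \<inter> R) \<le> p"
  shows "\<exists>v\<in>xspan (F ` R). mu n p \<le> card (v \<inter> R)"
proof -
  obtain b where b: "bij_betw b {..<n} R"
    using ex_bij_betw_nat_finite[OF assms(1)] assms(2) by (auto simp: lessThan_atLeast0)
  define W :: "bit mat" where "W = mat n n (\<lambda>(i, j). of_bool (b i \<in> F (b j)))"
  have b_in: "b i \<in> R" if "i < n" for i using b that by (auto simp: bij_betw_def)
  have count: "card {i. i < n \<and> b i \<in> v} = card (v \<inter> R)" for v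
  proof (rule bij_betw_same_card)
    show "bij_betw b {i. i < n \<and> b i \<in> v} (v \<inter> R)"
      using b unfolding bij_betw_def by (auto simp: inj_on_def)
  qed
  have "weight (col W j) \<le> p" if "j < n" for j
  proof -
    have "{i. i < dim_vec (col W j) \<and> col W j $ i = 1} = {i. i < n \<and> b i \<in> F (b j)}"
      using that by (auto simp: W_def)
    then show ?thesis using wt[OF b_in[OF that]] count by (simp add: weight_def)
  qed
  then have "W \<in> wirings n p"
    using diag b_in by (auto simp: wirings_def W_def)
  then have "mu n p \<le> max_weight W"
    unfolding mu_def using mu_set(1)[OF assms(3)] by (intro Min_le) auto
  have W: "W \<in> carrier_mat n n" by (simp add: W_def)
  have "max_weight W \<in> {weight (W *\<^sub>v x) | x. x \<in> carrier_vec (dim_col W)}"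
    unfolding max_weight_def by (rule Max_in[OF max_weight_set(1,2)[OF W]])
  then obtain x where x: "x \<in> carrier_vec n" "max_weight W = weight (W *\<^sub>v x)"
    using W by auto
  define v where "v = toggle_sum (\<lambda>j. F (b j)) {j \<in> {..<n}. x $ j = 1}"
  have "(W *\<^sub>v x) $ i = of_bool (b i \<in> v)" if "i < n" for i
    unfolding v_def using that W x(1) by (intro mult_mat_vec_toggle_sum) (auto simp: W_def)
  then have "{i. i < dim_vec (W *\<^sub>v x) \<and> (W *\<^sub>v x) $ i = 1} = {i. i < n \<and> b i \<in> v}"
    using W by auto
  then have "weight (W *\<^sub>v x) = card (v \<inter> R)" by (simp add: weight_def count)
  moreover have "v \<in> xspan (F ` R)"
    unfolding v_def using b_in by (intro toggle_sum_in_xspan) auto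
  ultimately show ?thesis using x(2) \<open>mu n p \<le> max_weight W\<close> by auto
qed

text \<open>Stated for any finite vertex set whose columns may leave it. The induction can then be
  applied to the remainder \<open>R\<close> while the columns keep their entries on the pure
  blocks.\<close>

lemma pivots_to_V_copies:
  fixes F :: "'a \<Rightarrow> 'a set"
  assumes "q \<ge> 1"
    and "\<And>n p. n \<ge> 1 \<Longrightarrow> p \<ge> 1 \<Longrightarrow> p < 2 ^ k \<Longrightarrow> mu n p = U n p"
    and "finite S" "card S = q * (2 * 2 ^ k - 1)"
    and "\<And>j. j \<in> S \<Longrightarrow> j \<in> F j" "\<And>j. j \<in> S \<Longrightarrow> card (F j \<inter> S) \<le> 2 ^ k"
    and "\<And>v. v \<in> xspan (F ` S) \<Longrightarrow> card (v \<inter> S) \<le> q * 2 ^ k"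
  shows "\<exists>G f. (F, G) \<in> (partial_pivots S)\<^sup>* \<and> V_copies S k q G f"
  using assms(2-)
proof (induction k arbitrary: S F)
  case 0
  obtain b where b: "bij_betw b {..<q} S"
    using ex_bij_betw_nat_finite[OF 0(2)] 0(3) by (auto simp: lessThan_atLeast0)
  \<comment> \<open>For \<open>k = 0\<close> the weight bound leaves only the diagonal entry, and no
    pivot is required.\<close>
  have F_sing: "F j \<inter> S = {j}" if "j \<in> S" for j
  proof -
    have "{j} \<subseteq> F j \<inter> S" using 0(4) that by auto
    then show ?thesis using card_seteq[of "F j \<inter> S" "{j}"] 0(5)[OF that] 0(2) by auto
  qed
  have b_in: "b u \<in> S" if "u < q" for u using b that by (auto simp: bij_betw_def)
  have b_eq: "b u = b u' \<longleftrightarrow> u = u'" if "u < q" "u' < q" for u u'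
    using b that by (auto simp: bij_betw_def inj_on_def)
  have b_F: "b u' \<in> F (b u) \<longleftrightarrow> u = u'" if "u < q" "u' < q" for u u'
    using F_sing[OF b_in[OF that(1)]] b_in[OF that(2)] b_eq[OF that]
    by (metis Int_iff singletonD singletonI)
  have Y: "{1..<2 ^ (0 + 1) :: nat} = {1}" by auto
  have "bij_betw (\<lambda>p. b (fst p)) ({..<q} \<times> {1::nat}) S"
    using b unfolding bij_betw_def by (auto simp: inj_on_def image_iff)
  then have "V_copies S 0 q F (\<lambda>p. b (fst p))"
    unfolding V_copies_def Y using b_F by (simp add: bit_0)
  then show ?case by blast
next
  case (Suc k)
  note hyp = Suc.prems(1) and finS = Suc.prems(2) and card_S = Suc.prems(3) and diag = Suc.prems(4)
    and wt = Suc.prems(5) and bound = Suc.prems(6)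
  define h :: nat where "h = 2 ^ k"
  have h: "2 ^ Suc k = 2 * h" "h \<ge> 1" by (simp_all add: h_def)
  have empty: "pure_blocks S (2 ^ Suc k) F {}" by (simp add: pure_blocks_def)
  obtain G \<A> where FG: "(F, G) \<in> (partial_pivots S)\<^sup>*"
    and pure: "pure_blocks S (2 ^ Suc k) G \<A>"
    and small: "\<forall>j\<in>S - \<Union>\<A>. card (G j \<inter> (S - \<Union>\<A>)) < 2 ^ Suc k"
    using extract_pure_blocks[OF finS _ diag wt empty] by auto
  note G = partial_pivots_rtrancl[OF FG]
  note pure_D = pure_blocksD[OF pure]
  define R where "R = S - \<Union>\<A>"
  have finR: "finite R" and R_sub: "R \<subseteq> S" using finS by (auto simp: R_def)
  have G_diag: "j \<in> G j" if "j \<in> S" for j using G(3) diag that by blast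
  have G_wt: "card (G j \<inter> S) \<le> 2 ^ Suc k" if "j \<in> S" for j
  proof -
    have "G j \<in> F ` S" using G(1) that by blast
    then show ?thesis using wt by auto
  qed
  have G_bound: "card (v \<inter> S) \<le> q * 2 ^ Suc k" if "v \<in> xspan (G ` S)" for v
    using bound[OF xspan_mono[OF that G(1)]] .
  have pure_bound: "card (v \<inter> R) +
      (\<Sum>B\<in>\<A>. max (card (v \<inter> B)) (2 ^ Suc k - card (v \<inter> B))) \<le> q * 2 ^ Suc k"
    if "v \<in> xspan (G ` S)" for v
    unfolding R_def by (rule pure_blocks_bound[OF pure finS _ G_bound that]) auto
  have R_diag: "j \<in> G j" if "j \<in> R" for j using G_diag that R_sub by blast
  have R_small: "card (G j \<inter> R) \<le> 2 * h - 1" if "j \<in> R" for j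
  proof -
    have "card (G j \<inter> R) < 2 * h" using small that unfolding R_def h(1) by blast
    then show ?thesis by linarith
  qed
  define t where "t = card \<A>"
  have "card (\<Union>\<A>) = (\<Sum>B\<in>\<A>. card B)"
    using pure_D(2) by (intro card_Union_disjoint) (auto intro: finite_subset[OF pure_D(3) finS])
  then have card_UA: "card (\<Union>\<A>) = t * (2 * h)" using pure_D(4) h by (simp add: t_def)
  have UA_sub: "\<Union>\<A> \<subseteq> S" using pure_D(3) by blast
  then have card_R: "card R + t * (2 * h) = card S"
    using card_Diff_subset[OF finite_subset[OF UA_sub finS] UA_sub] card_mono[OF finS UA_sub] card_UA
    by (simp add: R_def)
  \<comment> \<open>The zero vector makes every maximum equal to \<open>2 * h\<close>.\<close>
  have "t * (2 * h) \<le> q * (2 * h)"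
    using pure_bound[OF xspan.empty] h by (simp add: t_def)
  then have "t \<le> q" using h by simp
  moreover have "\<not> t < q"
  proof
    assume "t < q"
    have "2 * h - 1 \<ge> 1" using h(2) by linarith
    define r where "r = q - t"
    have r: "q = t + r" "r \<ge> 1" using \<open>t < q\<close> by (auto simp: r_def)
    obtain g where g: "h = Suc g" using h(2) by (cases h) auto
    have "card R + t * (2 * h) = (t + r) * (2 * (2 * h) - 1)"
      using card_R card_S h r by simp
    \<comment> \<open>Since \<open>4 * h - 1 = 2 * (2 * h - 1) + 1\<close>, a deficit of
      \<open>r\<close> blocks yields \<open>2 * r\<close> further periods of length
      \<open>2 * h - 1\<close> and \<open>r\<close> vertices left over, as \<open>U_ge\<close>
      expects.\<close>
    then have "card R = (t + 2 * r) * (2 * h - 1) + r"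
      by (simp add: g algebra_simps)
    then have U: "(t + 2 * r) * h + 1 \<le> U (card R) (2 * h - 1)" and "card R \<ge> 1"
      using U_ge[of "card R" "t + 2 * r" k r] r by (simp_all add: h_def)
    have "mu (card R) (2 * h - 1) = U (card R) (2 * h - 1)"
      using hyp[of "card R" "2 * h - 1"] \<open>card R \<ge> 1\<close> h by simp
    moreover obtain v where v: "v \<in> xspan (G ` R)" "mu (card R) (2 * h - 1) \<le> card (v \<inter> R)"
      using mu_attained[OF finR refl _ R_diag R_small] \<open>2 * h - 1 \<ge> 1\<close> by blast
    moreover have "v \<in> xspan (G ` S)" using xspan_mono[OF v(1)] R_sub by blast
    note pure_bound[OF this]
    moreover have "t * h \<le> (\<Sum>B\<in>\<A>. max (card (v \<inter> B)) (2 ^ Suc k - card (v \<inter> B)))"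
      unfolding t_def h(1) using sum_bounded_below[of \<A> h] by auto
    \<comment> \<open>Counting only \<open>h\<close> for each block, the total already exceeds
      \<open>q * (2 * h)\<close> by 1.\<close>
    ultimately have "(t + 2 * r) * h + 1 + t * h \<le> (t + r) * (2 * h)"
      using U unfolding h(1) r(1) by linarith
    then show False by (simp add: algebra_simps)
  qed
  ultimately have t: "t = q" by simp
  have card_R': "card R = q * (2 * 2 ^ k - 1)"
  proof -
    obtain g where g: "h = Suc g" using h(2) by (cases h) auto
    have "card R + q * (2 * h) = q * (2 * (2 * h) - 1)" using card_R card_S h t by simp
    then have "card R = q * (2 * h - 1)" by (simp add: g algebra_simps)
    then show ?thesis by (simp add: h_def)
  qed
  \<comment> \<open>Every block costs at least \<open>h\<close>, whatever \<open>v\<close>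
    is.\<close>
  have R_bound: "card (v \<inter> R) \<le> q * 2 ^ k" if "v \<in> xspan (G ` R)" for v
  proof -
    have "v \<in> xspan (G ` S)" using xspan_mono[OF that] R_sub by blast
    note pure_bound[OF this]
    moreover have "q * h \<le> (\<Sum>B\<in>\<A>. max (card (v \<inter> B)) (2 ^ Suc k - card (v \<inter> B)))"
      unfolding t[symmetric] t_def h(1) using sum_bounded_below[of \<A> h] by auto
    ultimately have "card (v \<inter> R) + q * h \<le> q * (2 * h)"
      unfolding h(1) by linarith
    then show ?thesis by (simp add: h_def)
  qed
  \<comment> \<open>Each maximum plus \<open>card (G j \<inter> B)\<close> is at least
    \<open>2 * h\<close>, so the bound makes the weight on \<open>R\<close> at most the weight on
    the blocks. The two add up to at most \<open>2 * h\<close>.\<close>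
  have R_wt: "card (G j \<inter> R) \<le> 2 ^ k" if j: "j \<in> R" for j
  proof -
    have "j \<in> S" using j R_sub by blast
    then have "G j \<in> xspan (G ` S)" by (intro gen_in_xspan) auto
    note pure_bound[OF this]
    moreover have "q * (2 * h) \<le> (\<Sum>B\<in>\<A>. max (card (G j \<inter> B)) (2 ^ Suc k - card (G j \<inter> B))) +
        card (G j \<inter> \<Union>\<A>)"
    proof -
      have "q * (2 * h) = (\<Sum>B\<in>\<A>. 2 * h)" using t by (simp add: t_def)
      also have "\<dots> \<le> (\<Sum>B\<in>\<A>. max (card (G j \<inter> B)) (2 ^ Suc k - card (G j \<inter> B)) + card (G j \<inter> B))"
        using h by (intro sum_mono) auto
      also have "\<dots> = (\<Sum>B\<in>\<A>. max (card (G j \<inter> B)) (2 ^ Suc k - card (G j \<inter> B))) +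
          (\<Sum>B\<in>\<A>. card (G j \<inter> B))"
        by (rule sum.distrib)
      also have "(\<Sum>B\<in>\<A>. card (G j \<inter> B)) = card (\<Union>B\<in>\<A>. G j \<inter> B)"
      proof (rule card_UN_disjoint[symmetric])
        show "\<forall>B\<in>\<A>. finite (G j \<inter> B)" using finite_subset[OF pure_D(3) finS] by blast
        show "\<forall>B\<in>\<A>. \<forall>B'\<in>\<A>. B \<noteq> B' \<longrightarrow> G j \<inter> B \<inter> (G j \<inter> B') = {}"
          using disjointD[OF pure_D(2)] by blast
      qed (rule pure_D(1))
      also have "(\<Union>B\<in>\<A>. G j \<inter> B) = G j \<inter> \<Union>\<A>" by auto
      finally show ?thesis .
    qed
    moreover have "card (G j \<inter> R) + card (G j \<inter> \<Union>\<A>) \<le> 2 * h"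
    proof -
      have "card (G j \<inter> R) + card (G j \<inter> \<Union>\<A>) = card ((G j \<inter> R) \<union> (G j \<inter> \<Union>\<A>))"
        using finR finite_subset[OF UA_sub finS]
        by (intro card_Un_disjoint[symmetric]) (auto simp: R_def)
      also have "(G j \<inter> R) \<union> (G j \<inter> \<Union>\<A>) = G j \<inter> S" using UA_sub by (auto simp: R_def)
      finally show ?thesis using G_wt[OF \<open>j \<in> S\<close>] h by simp
    qed
    ultimately show ?thesis unfolding h(1) h_def[symmetric] by linarith
  qed
  have hyp': "mu n p = U n p" if "n \<ge> 1" "p \<ge> 1" "p < 2 ^ k" for n p
    using hyp that by simp
  obtain G' g where GG': "(G, G') \<in> (partial_pivots R)\<^sup>*" and copies: "V_copies R k q G' g"
    using Suc.IH[OF hyp' finR card_R' R_diag R_wt R_bound] by blast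
  have GG'_S: "(G, G') \<in> (partial_pivots S)\<^sup>*"
    using GG' rtrancl_mono[OF partial_pivots_mono[OF R_sub]] by blast
  note G' = partial_pivots_rtrancl[OF GG'_S]
  \<comment> \<open>Pivots inside \<open>R\<close> leave the columns of block vertices
    alone.\<close>
  have pure': "pure_blocks S (2 ^ Suc k) G' \<A>"
    by (rule pure_blocks_cong[OF pure], rule partial_pivots_rtrancl(2)[OF GG']) (auto simp: R_def)
  have G'_wt: "card (G' j \<inter> S) \<le> 2 ^ Suc k" if "j \<in> S" for j
  proof -
    have "G' j \<in> G ` S" using G'(1) that by blast
    then show ?thesis using G_wt by auto
  qed
  have G'_bound: "card (v \<inter> (S - \<Union>\<A>)) +
      (\<Sum>B\<in>\<A>. max (card (v \<inter> B)) (2 ^ Suc k - card (v \<inter> B))) \<le> q * 2 ^ Suc k"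
    if "v \<in> xspan (G' ` S)" for v
    using pure_bound[OF xspan_mono[OF that G'(1)]] by (simp only: R_def)
  obtain f where "V_copies S (Suc k) q G' f"
    using V_copies_step[OF finS pure' t[unfolded t_def] G'_wt G'_bound copies[unfolded R_def]]
    by blast
  then show ?case using rtrancl_trans[OF FG GG'_S] by blast
qed

subsection \<open>Transfer to matrices\<close>

text \<open>Adding the column of \<open>a\<close> inserts the index \<open>a\<close>, or removes it
  if it was present, since a column cancels itself.\<close>

lemma toggle_sum_sym_diff_gen:
  assumes "finite X"
  shows "\<exists>Y \<subseteq> insert a X. sym_diff (toggle_sum c X) (c a) = toggle_sum c Y"
proof (cases "a \<in> X")
  case True
  have "toggle_sum c X = sym_diff (toggle_sum c (X - {a})) (c a)"
    using toggle_sum_insert[of "X - {a}" a c] assms True by (simp add: insert_absorb)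
  then have "sym_diff (toggle_sum c X) (c a) = toggle_sum c (X - {a})" by auto
  then show ?thesis by (intro exI[of _ "X - {a}"]) auto
next
  case False
  then show ?thesis
    using toggle_sum_insert[OF assms False, of c] by (intro exI[of _ "insert a X"]) auto
qed

lemma xspan_image_toggle_sum:
  assumes "v \<in> xspan (F ` S)" "finite S"
  shows "\<exists>X \<subseteq> S. v = toggle_sum F X"
  using assms(1)
proof (induction rule: xspan.induct)
  case empty
  show ?case by (intro exI[of _ "{}"]) simp
next
  case (add v c)
  then obtain X a where X: "X \<subseteq> S" "v = toggle_sum F X" "a \<in> S" "c = F a" by auto
  then obtain Y where "Y \<subseteq> insert a X" "sym_diff v c = toggle_sum F Y"
    using toggle_sum_sym_diff_gen[of X a F] finite_subset[OF X(1) assms(2)] by blast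
  then show ?case using X by blast
qed

section \<open>Weights of column sums in copies of \<open>V k\<close>\<close>

lemma bit_floor_log:
  assumes "y \<ge> 1" shows "bit y (floor_log y)"
proof -
  have "y - 1 \<in> V_block (floor_log y)" using assms by (simp add: floor_log_V_block)
  from bit_top_block(1)[OF this] show ?thesis using assms by simp
qed

text \<open>A column of another copy is invisible on copy \<open>u\<close>, and a column of copy
  \<open>u\<close> reads off one bit of the label. Hence every sum is a linear form in the bits
  there.\<close>

lemma V_copies_slice:
  assumes copies: "V_copies S k q F f" and "v \<in> xspan (F ` S)" and u: "u < q"
  shows "\<exists>I \<subseteq> {..<k + 1}. \<forall>y\<in>{1..<2 ^ (k + 1)}.
    f (u, y) \<in> v \<longleftrightarrow> y \<in> toggle_sum (\<lambda>i. {y. bit y i}) I"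
  using assms(2)
proof (induction rule: xspan.induct)
  case empty
  show ?case by (intro exI[of _ "{}"]) simp
next
  case (add v c)
  then obtain I where I: "I \<subseteq> {..<k + 1}"
    "\<forall>y\<in>{1..<2 ^ (k + 1)}. f (u, y) \<in> v \<longleftrightarrow> y \<in> toggle_sum (\<lambda>i. {y. bit y i}) I" by blast
  obtain u' y' where c: "u' < q" "y' \<in> {1..<2 ^ (k + 1)}" "c = F (f (u', y'))"
  proof -
    obtain j where "j \<in> S" "c = F j" using add.hyps(2) by auto
    moreover have "S = f ` ({..<q} \<times> {1..<2 ^ (k + 1)})"
      using V_copies_bij[OF copies] by (simp add: bij_betw_def)
    ultimately show ?thesis using that by auto
  qed
  have entry: "f (u, y) \<in> c \<longleftrightarrow> u' = u \<and> bit y (floor_log y')" if "y \<in> {1..<2 ^ (k + 1)}" for y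
    unfolding c(3) by (rule V_copies_entry[OF copies c(1) u c(2) that])
  have lt: "floor_log y' < k + 1" by (rule floor_log_less[OF c(2)])
  show ?case
  proof (cases "u' = u")
    case True
    have "finite I" using I(1) finite_subset by blast
    then obtain J where J: "J \<subseteq> insert (floor_log y') I" "sym_diff (toggle_sum (\<lambda>i. {y. bit y i}) I)
        {y. bit y (floor_log y')} = toggle_sum (\<lambda>i. {y. bit (y::nat) i}) J"
      using toggle_sum_sym_diff_gen[of I "floor_log y'" "\<lambda>i. {y. bit (y::nat) i}"] by blast
    have "f (u, y) \<in> sym_diff v c \<longleftrightarrow> y \<in> toggle_sum (\<lambda>i. {y. bit y i}) J"
      if "y \<in> {1..<2 ^ (k + 1)}" for y
      using I(2) entry[OF that] that True unfolding J(2)[symmetric] by auto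
    moreover have "J \<subseteq> {..<k + 1}" using J(1) I(1) lt by auto
    ultimately show ?thesis by blast
  next
    case False
    then show ?thesis using I entry by blast
  qed
qed

lemma V_copies_slice_card:
  assumes "I \<subseteq> {..<k + 1}"
  shows "card {y \<in> {1..<2 ^ (k + 1)}. y \<in> toggle_sum (\<lambda>i. {y::nat. bit y i}) I} \<le> 2 ^ k"
proof (cases "I = {}")
  case False
  then show ?thesis using card_odd_bits[OF assms] by (simp add: toggle_sum_def)
qed simp

text \<open>Each of the \<open>q\<close> slices is a linear form on the nonzero labels, hence odd on
  at most \<open>2 ^ k\<close> of them.\<close>

lemma V_copies_weight:
  assumes copies: "V_copies S k q F f" and v: "v \<in> xspan (F ` S)"
  shows "card (v \<inter> S) \<le> q * 2 ^ k"
proof -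
  have S: "S = f ` ({..<q} \<times> {1..<2 ^ (k + 1)})"
    using V_copies_bij[OF copies] by (simp add: bij_betw_def)
  have "v \<inter> S = (\<Union>u<q. (\<lambda>y. f (u, y)) ` {y \<in> {1..<2 ^ (k + 1)}. f (u, y) \<in> v})"
    unfolding S by auto
  also have "card \<dots> \<le> (\<Sum>u<q. card ((\<lambda>y. f (u, y)) ` {y \<in> {1..<2 ^ (k + 1)}. f (u, y) \<in> v}))"
    by (rule card_UN_le) simp
  also have "\<dots> \<le> (\<Sum>u<q. 2 ^ k)"
  proof (rule sum_mono)
    fix u assume "u \<in> {..<q}"
    then obtain I where I: "I \<subseteq> {..<k + 1}" "\<forall>y\<in>{1..<2 ^ (k + 1)}.
        f (u, y) \<in> v \<longleftrightarrow> y \<in> toggle_sum (\<lambda>i. {y. bit y i}) I"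
      using V_copies_slice[OF copies v] by blast
    then have "{y \<in> {1..<2 ^ (k + 1)}. f (u, y) \<in> v} =
        {y \<in> {1..<2 ^ (k + 1)}. y \<in> toggle_sum (\<lambda>i. {y. bit y i}) I}" by blast
    then have "card {y \<in> {1..<2 ^ (k + 1)}. f (u, y) \<in> v} \<le> 2 ^ k"
      using V_copies_slice_card[OF I(1)] by simp
    then show "card ((\<lambda>y. f (u, y)) ` {y \<in> {1..<2 ^ (k + 1)}. f (u, y) \<in> v}) \<le> 2 ^ k"
      using card_image_le[of "{y \<in> {1..<2 ^ (k + 1)}. f (u, y) \<in> v}" "\<lambda>y. f (u, y)"] by simp
  qed
  finally show ?thesis by simp
qed

lemma V_copies_column_weight:
  assumes copies: "V_copies S k q F f" and j: "j \<in> S"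
  shows "card (F j \<inter> S) \<le> 2 ^ k"
proof -
  have S: "S = f ` ({..<q} \<times> {1..<2 ^ (k + 1)})"
    using V_copies_bij[OF copies] by (simp add: bij_betw_def)
  obtain u y where uy: "u < q" "y \<in> {1..<2 ^ (k + 1)}" "j = f (u, y)" using j S by auto
  have entry: "f (u', y') \<in> F j \<longleftrightarrow> u = u' \<and> bit y' (floor_log y)"
    if "u' < q" "y' \<in> {1..<2 ^ (k + 1)}" for u' y'
    unfolding uy(3) by (rule V_copies_entry[OF copies uy(1) that(1) uy(2) that(2)])
  let ?Y = "{y' \<in> {1..<2 ^ (k + 1)}. y' \<in> toggle_sum (\<lambda>i. {y::nat. bit y i}) {floor_log y}}"
  have "F j \<inter> S \<subseteq> (\<lambda>y'. f (u, y')) ` ?Y"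
  proof
    fix x assume x: "x \<in> F j \<inter> S"
    then obtain u' y' where x': "u' < q" "y' \<in> {1..<2 ^ (k + 1)}" "x = f (u', y')" using S by auto
    then have "u = u'" "bit y' (floor_log y)" using entry x by blast+
    then show "x \<in> (\<lambda>y'. f (u, y')) ` ?Y" using x' by auto
  qed
  then have "card (F j \<inter> S) \<le> card ?Y" by (rule surj_card_le[rotated]) simp
  also have "\<dots> \<le> 2 ^ k"
    using floor_log_less[OF uy(2)] by (intro V_copies_slice_card) auto
  finally show ?thesis .
qed

lemma V_copies_diag:
  assumes copies: "V_copies S k q F f" and j: "j \<in> S"
  shows "j \<in> F j"
proof -
  have "j \<in> f ` ({..<q} \<times> {1..<2 ^ (k + 1)})"
    using V_copies_bij[OF copies] j by (simp add: bij_betw_def)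
  then obtain u y where uy: "u < q" "y \<in> {1..<2 ^ (k + 1)}" "j = f (u, y)" by auto
  then show ?thesis
    using V_copies_entry[OF copies uy(1,1,2,2)] bit_floor_log[of y] by simp
qed

lemma diag_block_mat_replicate:
  assumes A: "A \<in> carrier_mat N N"
  shows "diag_block_mat (replicate q A) \<in> carrier_mat (q * N) (q * N)"
    and "i < q * N \<Longrightarrow> j < q * N \<Longrightarrow> diag_block_mat (replicate q A) $$ (i, j) =
      (if i div N = j div N then A $$ (i mod N, j mod N) else 0)"
proof (induction q arbitrary: i j)
  case (Suc q)
  case 1
  show ?case using A Suc(1) by (simp add: Let_def)
  case 2
  have dim: "dim_row A = N" "dim_col A = N" "dim_row (diag_block_mat (replicate q A)) = q * N"
    "dim_col (diag_block_mat (replicate q A)) = q * N" using A Suc(1) by auto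
  have "N > 0" using 2 by (cases N) auto
  have shift: "l div N = Suc ((l - N) div N) \<and> l mod N = (l - N) mod N" if "\<not> l < N" for l
    using that \<open>N > 0\<close> by (simp add: le_div_geq le_mod_geq)
  show ?case
    using 2 Suc(2)[of "i - N" "j - N"] shift[of i] shift[of j]
    by (auto simp: Let_def dim)
qed auto

lemma V_entry_floor_log:
  assumes "r < 2 ^ (k + 1) - 1" "j < 2 ^ (k + 1) - 1"
  shows "V k $$ (r, j) = of_bool (bit (r + 1) (floor_log (j + 1)))"
proof (rule V_entry[OF _ _ assms(1)])
  have "floor_log (j + 1) < k + 1" using assms(2) by (intro floor_log_less) auto
  then show "floor_log (j + 1) \<le> k" by simp
  show "j \<in> V_block (floor_log (j + 1))" by (simp add: floor_log_V_block)
qed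

section \<open>Column families as matrices\<close>

definition toggle_mat :: "nat \<Rightarrow> (nat \<Rightarrow> nat set) \<Rightarrow> bit mat" where
  "toggle_mat n F = mat n n (\<lambda>(i, j). of_bool (i \<in> F j))"

lemma toggle_mat_carrier [simp]: "toggle_mat n F \<in> carrier_mat n n"
  by (simp add: toggle_mat_def)

lemma toggle_mat_toggles:
  assumes "W \<in> carrier_mat n n" shows "toggle_mat n (toggles W) = W"
  using assms by (intro eq_matI) (auto simp: toggle_mat_def toggles_def)

lemma partial_pivot_toggle_mat:
  assumes "(F, G) \<in> partial_pivots {..<n}"
  shows "(toggle_mat n F, toggle_mat n G) \<in> pivot_rel"
proof -
  obtain i J where i: "i < n" "J \<subseteq> {..<n}" "G = (\<lambda>j. if j \<in> J \<inter> F i then F i else F j)"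
    using assms unfolding partial_pivots_def by auto
  \<comment> \<open>The set \<open>T\<close> of vertices exempt from the pivot is the complement of
    \<open>J\<close>.\<close>
  have "toggle_mat n G = pivot (toggle_mat n F) i ({..<n} - J)"
    using i by (intro eq_matI) (auto simp: toggle_mat_def pivot_def toggles_def)
  then show ?thesis
    using i(1) unfolding pivot_rel_def by (auto simp: toggle_mat_def)
qed

lemma partial_pivots_toggle_mat:
  assumes "(F, G) \<in> (partial_pivots {..<n})\<^sup>*"
  shows "(toggle_mat n F, toggle_mat n G) \<in> pivot_rel\<^sup>*"
  using assms
  by (induction rule: rtrancl_induct) (auto intro: rtrancl.rtrancl_into_rtrancl partial_pivot_toggle_mat)

lemma weight_col_toggles:
  assumes "W \<in> carrier_mat n n" "j < n"
  shows "weight (col W j) = card (toggles W j \<inter> {..<n})"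
proof -
  have "{i. i < dim_vec (col W j) \<and> col W j $ i = 1} = toggles W j \<inter> {..<n}"
    using assms by (auto simp: toggles_def)
  then show ?thesis by (simp add: weight_def)
qed

lemma weight_mult_toggle_sum:
  assumes "W \<in> carrier_mat n n" "x \<in> carrier_vec n"
  shows "weight (W *\<^sub>v x) = card (toggle_sum (toggles W) {j \<in> {..<n}. x $ j = 1} \<inter> {..<n})"
proof -
  have "(W *\<^sub>v x) $ i = of_bool (i \<in> toggle_sum (toggles W) {j \<in> {..<n}. x $ j = 1})" if "i < n" for i
    using assms that
    by (intro mult_mat_vec_toggle_sum[where b = "\<lambda>i. i"]) (auto simp: toggles_def)
  then have "{i. i < dim_vec (W *\<^sub>v x) \<and> (W *\<^sub>v x) $ i = 1} =
      toggle_sum (toggles W) {j \<in> {..<n}. x $ j = 1} \<inter> {..<n}"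
    using assms by auto
  then show ?thesis by (simp add: weight_def)
qed

lemma xspan_weight_le_max_weight:
  assumes W: "W \<in> carrier_mat n n" and v: "v \<in> xspan (toggles W ` {..<n})"
  shows "card (v \<inter> {..<n}) \<le> max_weight W"
proof -
  obtain X where X: "X \<subseteq> {..<n}" "v = toggle_sum (toggles W) X"
    using xspan_image_toggle_sum[OF v] by auto
  define x :: "bit vec" where "x = vec n (\<lambda>j. of_bool (j \<in> X))"
  have "{j \<in> {..<n}. x $ j = 1} = X" using X(1) by (auto simp: x_def)
  then have "weight (W *\<^sub>v x) = card (v \<inter> {..<n})"
    using weight_mult_toggle_sum[OF W, of x] X(2) by (simp add: x_def)
  moreover have "weight (W *\<^sub>v x) \<le> max_weight W"
    unfolding max_weight_def using W
    by (intro Max_ge[OF max_weight_set(1)[OF W]]) (auto simp: x_def)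
  ultimately show ?thesis by simp
qed

lemma max_weight_le:
  assumes W: "W \<in> carrier_mat n n"
    and le: "\<And>v. v \<in> xspan (toggles W ` {..<n}) \<Longrightarrow> card (v \<inter> {..<n}) \<le> Q"
  shows "max_weight W \<le> Q"
proof -
  have "max_weight W \<in> {weight (W *\<^sub>v x) | x. x \<in> carrier_vec (dim_col W)}"
    unfolding max_weight_def by (rule Max_in[OF max_weight_set(1,2)[OF W]])
  then obtain x where x: "x \<in> carrier_vec n" "max_weight W = weight (W *\<^sub>v x)"
    using W by auto
  have "toggle_sum (toggles W) {j \<in> {..<n}. x $ j = 1} \<in> xspan (toggles W ` {..<n})"
    by (intro toggle_sum_in_xspan) auto
  then show ?thesis using le x(2) weight_mult_toggle_sum[OF W x(1)] by simp
qed

section \<open>The block diagonal wiring\<close>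

lemma diag_V_entry:
  assumes "i < q * (2 ^ (k + 1) - 1)" "j < q * (2 ^ (k + 1) - 1)" and N: "N = 2 ^ (k + 1) - 1"
  shows "diag_block_mat (replicate q (V k)) $$ (i, j) =
    of_bool (i div N = j div N \<and> bit (i mod N + 1) (floor_log (j mod N + 1)))"
proof -
  have "N > 0" using assms by (cases N) auto
  then have "i mod N < 2 ^ (k + 1) - 1" "j mod N < 2 ^ (k + 1) - 1" using N by auto
  note V_entry_floor_log[OF this]
  then show ?thesis
    using diag_block_mat_replicate(2)[OF V_carrier[of k] assms(1,2)] unfolding N by simp
qed

text \<open>Labels start at 1, as in \<open>V_copies\<close>: the entries of \<open>V k\<close> are
  bits of the row index plus one.\<close>

lemma block_index_bij:
  fixes N :: nat
  assumes "N > 0"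
  shows "bij_betw (\<lambda>i. (i div N, i mod N + 1)) {..<q * N} ({..<q} \<times> {1..<N + 1})"
proof (rule bij_betwI[where g = "\<lambda>(u, y). u * N + (y - 1)"])
  show "(\<lambda>i. (i div N, i mod N + 1)) \<in> {..<q * N} \<rightarrow> {..<q} \<times> {1..<N + 1}"
    using assms by (auto simp: less_mult_imp_div_less)
  show "(\<lambda>(u, y). u * N + (y - 1)) \<in> {..<q} \<times> {1..<N + 1} \<rightarrow> {..<q * N}"
  proof
    fix p assume "p \<in> {..<q} \<times> {1..<N + 1}"
    then obtain u y where p: "p = (u, y)" "u < q" "y \<ge> 1" "y < N + 1" by auto
    have "Suc u * N \<le> q * N" using p(2) by (intro mult_le_mono1) simp
    moreover have "u * N + (y - 1) < Suc u * N" using p(3,4) by auto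
    ultimately show "(case p of (u, y) \<Rightarrow> u * N + (y - 1)) \<in> {..<q * N}" using p(1) by simp
  qed
  fix p assume "p \<in> {..<q} \<times> {1..<N + 1}"
  then obtain u y where p: "p = (u, y)" "y \<ge> 1" "y < N + 1" by auto
  obtain z where z: "y = Suc z" using p(2) by (cases y) auto
  show "((case p of (u, y) \<Rightarrow> u * N + (y - 1)) div N,
      (case p of (u, y) \<Rightarrow> u * N + (y - 1)) mod N + 1) = p" using p(1,3) unfolding z by simp
qed simp

text \<open>The target wiring itself is the witness, and its sums are bounded through
  \<open>V_copies_weight\<close>. This turns optimality of a wiring into the weight bound that
  starts the induction.\<close>

lemma mu_le_V:
  assumes "n = q * (2 ^ (k + 1) - 1)"
  shows "mu n (2 ^ k) \<le> q * 2 ^ k"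
proof -
  define N where "N = (2::nat) ^ (k + 1) - 1"
  define D where "D = diag_block_mat (replicate q (V k))"
  obtain g where g: "(2::nat) ^ k = Suc g" by (cases "(2::nat) ^ k") auto
  have N: "N > 0" "N + 1 = 2 ^ (k + 1)" by (simp_all add: N_def g)
  have n: "n = q * N" using assms by (simp add: N_def)
  have D: "D \<in> carrier_mat n n"
    unfolding D_def assms by (rule diag_block_mat_replicate(1)[OF V_carrier])
  define f where "f = inv_into {..<n} (\<lambda>i. (i div N, i mod N + 1))"
  have bij: "bij_betw f ({..<q} \<times> {1..<2 ^ (k + 1)}) {..<n}"
    using bij_betw_inv_into[OF block_index_bij[OF N(1), of q]] unfolding f_def n N(2) .
  have f: "f (u, y) < n \<and> f (u, y) div N = u \<and> f (u, y) mod N + 1 = y"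
    if "u < q" "y \<in> {1..<2 ^ (k + 1)}" for u y
  proof -
    have "f (u, y) \<in> {..<n}" using bij that by (auto simp: bij_betw_def)
    moreover have "(\<lambda>i. (i div N, i mod N + 1)) (f (u, y)) = (u, y)"
      unfolding f_def using that n N(2)
      by (intro bij_betw_inv_into_right[OF block_index_bij[OF N(1), of q, folded n]]) auto
    ultimately show ?thesis by simp
  qed
  have entry: "f (u', y') \<in> toggles D (f (u, y)) \<longleftrightarrow> u = u' \<and> bit y' (floor_log y)"
    if "u < q" "u' < q" "y \<in> {1..<2 ^ (k + 1)}" "y' \<in> {1..<2 ^ (k + 1)}" for u u' y y'
    using f[OF that(1,3)] f[OF that(2,4)] D
      diag_V_entry[of "f (u', y')" q k "f (u, y)", folded assms D_def, OF _ _ N_def]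
    by (auto simp: toggles_def)
  have column: "toggles D (f (u, y)) = toggles D (f (u, y'))"
    if "u < q" "y \<in> {1..<2 ^ (k + 1)}" "y' \<in> {1..<2 ^ (k + 1)}" "floor_log y = floor_log y'" for u y y'
    using f[OF that(1,2)] f[OF that(1,3)] D that(4)
      diag_V_entry[of _ q k "f (u, y)", folded assms D_def, OF _ _ N_def]
      diag_V_entry[of _ q k "f (u, y')", folded assms D_def, OF _ _ N_def]
    by (auto simp: toggles_def)
  have copies: "V_copies {..<n} k q (toggles D) f"
    unfolding V_copies_def using bij entry column by blast
  have "D $$ (i, i) = 1" if "i < n" for i
    using V_copies_diag[OF copies, of i] that by (simp add: toggles_def)
  moreover have "weight (col D j) \<le> 2 ^ k" if "j < n" for j
    using V_copies_column_weight[OF copies, of j] that weight_col_toggles[OF D that] by simp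
  ultimately have "D \<in> wirings n (2 ^ k)" using D by (simp add: wirings_def)
  then have "mu n (2 ^ k) \<le> max_weight D"
    unfolding mu_def using mu_set(1) by (intro Min_le) auto
  also have "\<dots> \<le> q * 2 ^ k"
    by (rule max_weight_le[OF D V_copies_weight[OF copies]])
  finally show ?thesis .
qed

text \<open>Splitting an index into copy and label and then applying \<open>f\<close> gives the
  permutation; both matrices test the same bit of the same label.\<close>

lemma V_copies_relabeling:
  assumes "n = q * (2 ^ (k + 1) - 1)" and copies: "V_copies {..<n} k q G f"
  shows "relabeling (toggle_mat n G) (diag_block_mat (replicate q (V k)))"
proof -
  define N where "N = (2::nat) ^ (k + 1) - 1"
  obtain g where g: "(2::nat) ^ k = Suc g" by (cases "(2::nat) ^ k") auto
  have N: "N > 0" "N + 1 = 2 ^ (k + 1)" by (simp_all add: N_def g)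
  have n: "n = q * N" using assms by (simp add: N_def)
  \<comment> \<open>The identity outside \<open>{..<n}\<close> is what \<open>permutes\<close>
    demands.\<close>
  define \<pi> where "\<pi> i = (if i < n then f (i div N, i mod N + 1) else i)" for i
  have "bij_betw (f \<circ> (\<lambda>i. (i div N, i mod N + 1))) {..<n} {..<n}"
    using bij_betw_trans[OF block_index_bij[OF N(1), of q]] V_copies_bij[OF copies]
    unfolding n N(2) by blast
  then have "bij_betw \<pi> {..<n} {..<n}"
    by (rule bij_betw_cong[THEN iffD1, rotated]) (auto simp: \<pi>_def)
  then have perm: "\<pi> permutes {..<n}" by (rule bij_imp_permutes) (auto simp: \<pi>_def)
  have idx: "i div N < q \<and> i mod N + 1 \<in> {1..<2 ^ (k + 1)}" if "i < n" for i
    using bij_betwE[OF block_index_bij[OF N(1), of q]] that unfolding n N(2) by auto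
  have "toggle_mat n G $$ (\<pi> i, \<pi> j) = diag_block_mat (replicate q (V k)) $$ (i, j)"
    if ij: "i < n" "j < n" for i j
  proof -
    have "\<pi> i < n" "\<pi> j < n" using permutes_in_image[OF perm] ij by auto
    then have "toggle_mat n G $$ (\<pi> i, \<pi> j) = of_bool (\<pi> i \<in> G (\<pi> j))"
      by (simp add: toggle_mat_def)
    also have "\<pi> i \<in> G (\<pi> j) \<longleftrightarrow> j div N = i div N \<and> bit (i mod N + 1) (floor_log (j mod N + 1))"
      using V_copies_entry[OF copies, of "j div N" "i div N" "j mod N + 1" "i mod N + 1"]
        idx[OF ij(1)] idx[OF ij(2)] ij by (simp only: \<pi>_def if_True)
    finally show ?thesis
      using diag_V_entry[of i q k j N] ij assms(1) by (simp only: N_def eq_commute)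
  qed
  moreover have "diag_block_mat (replicate q (V k)) \<in> carrier_mat n n"
    unfolding assms(1) by (rule diag_block_mat_replicate(1)[OF V_carrier])
  ultimately show ?thesis
    unfolding relabeling_def using perm toggle_mat_carrier by blast
qed

theorem theorem5p4:
  fixes k m n q :: nat and W :: "bit mat"
  assumes "m = 2 ^ k"
    and "\<And>n' p. n' \<ge> 1 \<Longrightarrow> p \<ge> 1 \<Longrightarrow> p < m \<Longrightarrow> mu n' p = U n' p"
    and "q \<ge> 1"
    and "n = q * (2 * m - 1)"
    and "W \<in> wirings n m"
    and "max_weight W = mu n m"
  shows "\<exists>W'. (W, W') \<in> pivot_rel\<^sup>* \<and> relabeling W' (diag_block_mat (replicate q (V k)))"
proof -
  have n: "n = q * (2 ^ (k + 1) - 1)" using assms(1,4) by simp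
  have W: "W \<in> carrier_mat n n" and diag: "\<And>i. i < n \<Longrightarrow> W $$ (i, i) = 1"
    and wt: "\<And>j. j < n \<Longrightarrow> weight (col W j) \<le> m"
    using assms(5) by (auto simp: wirings_def)
  have "\<exists>G f. (toggles W, G) \<in> (partial_pivots {..<n})\<^sup>* \<and> V_copies {..<n} k q G f"
  proof (rule pivots_to_V_copies[OF assms(3)])
    show "mu n' p = U n' p" if "n' \<ge> 1" "p \<ge> 1" "p < 2 ^ k" for n' p
      using assms(1,2) that by simp
    show "card {..<n} = q * (2 * 2 ^ k - 1)" using assms(1,4) by simp
    show "j \<in> toggles W j" if "j \<in> {..<n}" for j
      using W diag that by (simp add: toggles_def)
    show "card (toggles W j \<inter> {..<n}) \<le> 2 ^ k" if "j \<in> {..<n}" for j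
      using wt weight_col_toggles[OF W] assms(1) that by simp
    \<comment> \<open>Optimality of \<open>W\<close> enters here: its maximum equals
      \<open>mu n m\<close>, which \<open>mu_le_V\<close> bounds.\<close>
    show "card (v \<inter> {..<n}) \<le> q * 2 ^ k" if "v \<in> xspan (toggles W ` {..<n})" for v
      using xspan_weight_le_max_weight[OF W that] mu_le_V[OF n] assms(1,6) by simp
  qed simp
  then obtain G f where "(toggles W, G) \<in> (partial_pivots {..<n})\<^sup>*" "V_copies {..<n} k q G f"
    by blast
  then show ?thesis
    using partial_pivots_toggle_mat V_copies_relabeling[OF n] toggle_mat_toggles[OF W] by metis
qed

end
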